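(* Let $V$ be a finite set and let $B_V$ be the set of coloured graphs with vertex set $V$ whose graph colouring is edge regular. Let $\mathcal{S}^{+}_{B_V}=\{\mathcal{S}^{+}(\mathcal{V},\mathcal{E}) : (\mathcal{V},\mathcal{E})\in B_V\}$ be the corresponding set of RCON models. Then $\mathcal{S}^{+}_{B_V}$ is a complete non-distributive lattice with respect to model inclusion (set inclusion). Its meet operation is induced by the meet operation of $\langle\mathcal{C}_V;\preceq\rangle$: for $\mathcal{G},\mathcal{H}\in B_V$, the meet of the models represented by $\mathcal{G}$ and $\mathcal{H}$ is the model represented by $\mathcal{G}\wedge\mathcal{H}$. The join of the models represented by $\mathcal{G},\mathcal{H}\in B_V$ is the model represented by $s_B(\mathcal{G}\vee\mathcal{H})$.
   Context: Graphs are undirected and simple. A coloured graph with vertex set $V$ is a pair $\mathcal{G}=(\mathcal{V},\mathcal{E})$ where $\mathcal{V}$ is a partition of $V$ (vertex colour classes) and $\mathcal{E}$ is a partition of the edge set $E$ of some graph $G=(V,E)$ (edge colour classes); $G$ is the underlying uncoloured graph. $\mathcal{C}_V$ is the set of all coloured graphs with vertex set $V$. For partitions $P_1,P_2$ of the same set, $P_1\le P_2$ means $P_1$ is finer than $P_2$ (every set in $P_2$ is a union of sets in $P_1$); $\wedge,\vee$ for partitions are the infimum and supremum for this order. Partial order on $\mathcal{C}_V$: for $\mathcal{G}=(\mathcal{V}_{\mathcal{G}},\mathcal{E}_{\mathcal{G}})$ and $\mathcal{H}=(\mathcal{V}_{\mathcal{H}},\mathcal{E}_{\mathcal{H}})$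 with edge sets $E_{\mathcal{G}},E_{\mathcal{H}}$, $\mathcal{G}\preceq\mathcal{H}$ iff (i) $E_{\mathcal{G}}\subseteq E_{\mathcal{H}}$, (ii) $\mathcal{V}_{\mathcal{G}}\ge\mathcal{V}_{\mathcal{H}}$, (iii) every class in $\mathcal{E}_{\mathcal{G}}$ is a union of classes in $\mathcal{E}_{\mathcal{H}}$. $\langle\mathcal{C}_V;\preceq\rangle$ is a complete lattice with $$\mathcal{G}\wedge\mathcal{H}=(\mathcal{V}_{\mathcal{G}}\vee\mathcal{V}_{\mathcal{H}},\ \mathcal{E}^{*}_{\mathcal{G}}\vee\mathcal{E}^{*}_{\mathcal{H}}),\qquad \mathcal{G}\vee\mathcal{H}=(\mathcal{V}_{\mathcal{G}}\wedge\mathcal{V}_{\mathcal{H}},\ \mathcal{E}^{**}_{\mathcal{G}}\wedge\mathcal{E}^{**}_{\mathcal{H}}),$$ where $\mathcal{E}^{*}_{\mathcal{G}}\subseteq\mathcal{E}_{\mathcal{G}}$ and $\mathcal{E}^{*}_{\mathcal{H}}\subseteq\mathcal{E}_{\mathcal{H}}$ are maximal with the property that they are partitions of the same subset of $E_{\mathcal{G}}\cap E_{\mathcal{H}}$, $\mathcal{E}^{**}_{\mathcal{G}}=\mathcal{E}_{\mathcal{G}}\cup\{E_{\mathcal{H}}\setminus E_{\mathcal{G}}\}$ and $\mathcal{E}^{**}_{\mathcal{H}}=\mathcal{E}_{\mathcal{H}}\cup\{E_{\mathcal{G}}\setminus E_{\mathcal{H}}\}$ (empty sets omitted). For $(\mathcal{V},\mathcal{E})\in\mathcal{C}_V$,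 the RCON model represented by it is identified with the set $\mathcal{S}^{+}(\mathcal{V},\mathcal{E})$ of symmetric positive definite real matrices $K=(k_{\alpha\beta})_{\alpha,\beta\in V}$ such that $k_{\alpha\beta}=0$ for $\alpha\ne\beta$ with $\alpha\beta\notin E$, $k_{\alpha\alpha}=k_{\beta\beta}$ whenever $\alpha,\beta$ lie in the same class of $\mathcal{V}$, and $k_{\alpha\beta}=k_{\gamma\delta}$ whenever the edges $\alpha\beta,\gamma\delta$ lie in the same class of $\mathcal{E}$. $(\mathcal{V},\mathcal{E})$ is edge regular if any pair of edges in the same edge colour class connects the same vertex colour classes (i.e. the unordered pairs of vertex colour classes of their endpoints coincide). For $\mathcal{G}=(\mathcal{V},\mathcal{E})\in\mathcal{C}_V$ with edge set $E$, let $\mathcal{E}_B$ be the partition of $E$ which puts two edges in the same set iff they connect the same vertex colour classes of $\mathcal{V}$, and let $s_B(\mathcal{G})=(\mathcal{V},\mathcal{E}\wedge\mathcal{E}_B)$. A lattice is distributive if $a\vee(b\wedge c)=(a\vee b)\wedge(a\vee c)$ for all $a,b,c$, and non-distributive otherwise.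
   Formalization: Non-distributivity is claimed only when V has at least 3 elements; for |V| ≤ 1 the lattice has one element and for |V| = 2 it is a product of two 2-element chains, both distributive. All other claims are for every finite V. *)

theory Defs
  imports Complex_Main "HOL-Library.Disjoint_Sets" "HOL-Library.FuncSet" "HOL-Algebra.Complete_Lattice"
begin

section \<open>Partitions\<close>

text \<open>Finer partitions are smaller; \<open>\<sqinter>\<close> and \<open>\<squnion>\<close> in this order are the partition operations
  \<open>\<and>\<close> and \<open>\<or>\<close>.\<close>

definition partition_order :: "'a set \<Rightarrow> 'a set set gorder" where
  "partition_order A = \<lparr>carrier = {P. partition_on A P}, eq = (=), le = refines A\<rparr>"

lemma partition_on_same_class:
  "partition_on A P \<Longrightarrow> X \<in> P \<Longrightarrow> Y \<in> P \<Longrightarrow> x \<in> X \<Longrightarrow> x \<in> Y \<Longrightarrow> X = Y"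
  unfolding partition_on_def disjoint_def by blast

lemma partition_on_subset:
  "partition_on A P \<Longrightarrow> D \<subseteq> P \<Longrightarrow> partition_on (\<Union>D) D"
  unfolding partition_on_def by (meson pairwise_subset subsetD)

lemma refines_iff_unions:
  assumes P: "partition_on A P" and Q: "partition_on A Q"
  shows "refines A P Q \<longleftrightarrow> (\<forall>Y\<in>Q. \<exists>D\<subseteq>P. Y = \<Union>D)"
proof
  assume r: "refines A P Q"
  show "\<forall>Y\<in>Q. \<exists>D\<subseteq>P. Y = \<Union>D"
  proof
    fix Y assume "Y \<in> Q"
    from refines_obtains_subset[OF r this] have "Y = \<Union>{p \<in> P. p \<subseteq> Y}"
      by (simp add: partition_on_def)
    then show "\<exists>D\<subseteq>P. Y = \<Union>D" by (metis (no_types, lifting) mem_Collect_eq subsetI)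
  qed
next
  assume u: "\<forall>Y\<in>Q. \<exists>D\<subseteq>P. Y = \<Union>D"
  have "\<exists>Y\<in>Q. X \<subseteq> Y" if X: "X \<in> P" for X
  proof -
    have "X \<noteq> {}" using P X partition_onD3 by metis
    then obtain x where x: "x \<in> X" by blast
    then have "x \<in> \<Union>Q" using X P Q by (metis UnionI partition_onD1)
    then obtain Y where Y: "Y \<in> Q" "x \<in> Y" by blast
    then obtain D where D: "D \<subseteq> P" "Y = \<Union>D" using u by blast
    then obtain Z where "Z \<in> D" "x \<in> Z" using Y by blast
    then have "Z = X" using partition_on_same_class[OF P _ X _ x] D by blast
    then show ?thesis using Y D \<open>Z \<in> D\<close> by blast
  qed
  then show "refines A P Q" using P Q by (simp add: refines_def)
qed

lemma complete_lattice_partition_order: "complete_lattice (partition_order A)"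
proof -
  interpret partial_order "partition_order A"
    by unfold_locales
      (auto simp: partition_order_def refines_refl dest: refines_asym intro: refines_trans)
  show ?thesis
  proof (rule complete_lattice_criterion1)
    have "partition_on A ({A} - {{}})"
      by (auto simp: partition_on_def disjoint_def)
    moreover have "refines A P ({A} - {{}})" if "partition_on A P" for P
      using that calculation by (auto simp: refines_def partition_on_def)
    ultimately show "\<exists>g. greatest (partition_order A) g (carrier (partition_order A))"
      by (auto simp: greatest_def partition_order_def)
  next
    fix PP assume PP: "PP \<subseteq> carrier (partition_order A)" "PP \<noteq> {}"
    then have part: "\<And>P. P \<in> PP \<Longrightarrow> partition_on A P"
      by (auto simp: partition_order_def)
    then have pc: "partition_on A (common_refinement PP)"
      using PP by (intro partition_on_common_refinement) auto
    have "refines A R (common_refinement PP)"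
      if R: "partition_on A R" "\<And>P. P \<in> PP \<Longrightarrow> refines A R P" for R
      by (rule common_refinement_coarsest) (use R PP part in auto)
    moreover have "refines A (common_refinement PP) P" if "P \<in> PP" for P
      using that pc part common_refinement_exists by (fastforce simp: refines_def)
    ultimately have "is_glb (partition_order A) (common_refinement PP) PP"
      using pc part PP by (intro greatest_LowerI) (auto simp: partition_order_def Lower_def)
    then show "\<exists>i. is_glb (partition_order A) i PP" by blast
  qed
qed


section \<open>Coloured graphs\<close>

text \<open>An edge is a two-element set of vertices. A coloured graph is a pair of a vertex colouring
  and an edge colouring; its edge set is the union of the edge colour classes.\<close>

type_synonym 'v coloured_graph = "'v set set \<times> 'v set set set"

definition edge_set :: "'v coloured_graph \<Rightarrow> 'v set set" where
  "edge_set G = \<Union>(snd G)"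

definition coloured_graphs :: "'v set \<Rightarrow> 'v coloured_graph set" where
  "coloured_graphs V = {G. partition_on V (fst G) \<and>
     (\<exists>E. E \<subseteq> {e. e \<subseteq> V \<and> card e = 2} \<and> partition_on E (snd G))}"

definition coloured_graph_le :: "'v set \<Rightarrow> 'v coloured_graph \<Rightarrow> 'v coloured_graph \<Rightarrow> bool" where
  "coloured_graph_le V G H \<longleftrightarrow> edge_set G \<subseteq> edge_set H \<and> refines V (fst H) (fst G) \<and>
     (\<forall>C\<in>snd G. \<exists>D\<subseteq>snd H. C = \<Union>D)"

definition coloured_graph_order :: "'v set \<Rightarrow> 'v coloured_graph gorder" where
  "coloured_graph_order V =
     \<lparr>carrier = coloured_graphs V, eq = (=), le = coloured_graph_le V\<rparr>"

text \<open>For an edge \<open>e\<close> with endpoints \<open>a\<close> and \<open>b\<close>, this is the unordered pair of the classes of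
  \<open>a\<close> and \<open>b\<close>, a singleton when the two classes coincide.\<close>

definition connected_classes :: "'v set set \<Rightarrow> 'v set \<Rightarrow> 'v set set" where
  "connected_classes \<V> e = {C \<in> \<V>. C \<inter> e \<noteq> {}}"

definition edge_regular :: "'v coloured_graph \<Rightarrow> bool" where
  "edge_regular G \<longleftrightarrow>
     (\<forall>C\<in>snd G. \<forall>e\<in>C. \<forall>f\<in>C. connected_classes (fst G) e = connected_classes (fst G) f)"

definition edge_regular_graphs :: "'v set \<Rightarrow> 'v coloured_graph set" where
  "edge_regular_graphs V = {G \<in> coloured_graphs V. edge_regular G}"

definition connection_partition :: "'v coloured_graph \<Rightarrow> 'v set set set" where
  "connection_partition G =
     (\<lambda>e. {f \<in> edge_set G. connected_classes (fst G) f = connected_classes (fst G) e}) ` edge_set G"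

definition s_B :: "'v coloured_graph \<Rightarrow> 'v coloured_graph" where
  "s_B G = (fst G, snd G \<sqinter>\<^bsub>partition_order (edge_set G)\<^esub> connection_partition G)"


section \<open>RCON models\<close>

text \<open>A matrix with rows and columns indexed by \<open>V\<close> is an extensional function on \<open>V \<times> V\<close>.\<close>

definition sym_pos_def :: "'v set \<Rightarrow> ('v \<times> 'v \<Rightarrow> real) \<Rightarrow> bool" where
  "sym_pos_def V K \<longleftrightarrow> K \<in> V \<times> V \<rightarrow>\<^sub>E UNIV \<and> (\<forall>a\<in>V. \<forall>b\<in>V. K (a, b) = K (b, a)) \<and>
     (\<forall>x. (\<exists>a\<in>V. x a \<noteq> 0) \<longrightarrow> 0 < (\<Sum>a\<in>V. \<Sum>b\<in>V. x a * K (a, b) * x b))"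

definition rcon_model :: "'v set \<Rightarrow> 'v coloured_graph \<Rightarrow> ('v \<times> 'v \<Rightarrow> real) set" where
  "rcon_model V G = {K. sym_pos_def V K \<and>
     (\<forall>a\<in>V. \<forall>b\<in>V. a \<noteq> b \<and> {a, b} \<notin> edge_set G \<longrightarrow> K (a, b) = 0) \<and>
     (\<forall>C\<in>fst G. \<forall>a\<in>C. \<forall>b\<in>C. K (a, a) = K (b, b)) \<and>
     (\<forall>C\<in>snd G. \<forall>a b c d. {a, b} \<in> C \<and> {c, d} \<in> C \<longrightarrow> K (a, b) = K (c, d))}"

definition edge_regular_models :: "'v set \<Rightarrow> ('v \<times> 'v \<Rightarrow> real) set gorder" where
  "edge_regular_models V =
     \<lparr>carrier = rcon_model V ` edge_regular_graphs V, eq = (=), le = (\<subseteq>)\<rparr>"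

definition distributive :: "'a gorder \<Rightarrow> bool" where
  "distributive L \<longleftrightarrow> (\<forall>a\<in>carrier L. \<forall>b\<in>carrier L. \<forall>c\<in>carrier L.
     a \<squnion>\<^bsub>L\<^esub> (b \<sqinter>\<^bsub>L\<^esub> c) = (a \<squnion>\<^bsub>L\<^esub> b) \<sqinter>\<^bsub>L\<^esub> (a \<squnion>\<^bsub>L\<^esub> c))"


section \<open>Explicit meet and join of coloured graphs\<close>

lemma coloured_graphs_iff:
  "G \<in> coloured_graphs V \<longleftrightarrow> partition_on V (fst G) \<and>
     edge_set G \<subseteq> {e. e \<subseteq> V \<and> card e = 2} \<and> partition_on (edge_set G) (snd G)"
  unfolding coloured_graphs_def edge_set_def by (auto simp: partition_on_def)

lemma union_iff: "(\<exists>D\<subseteq>P. X = \<Union>D) \<longleftrightarrow> (\<forall>x\<in>X. \<exists>p\<in>P. x \<in> p \<and> p \<subseteq> X)"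
proof
  assume "\<forall>x\<in>X. \<exists>p\<in>P. x \<in> p \<and> p \<subseteq> X"
  then have "X = \<Union>{p \<in> P. p \<subseteq> X}" by blast
  then show "\<exists>D\<subseteq>P. X = \<Union>D" by (intro exI[of _ "{p \<in> P. p \<subseteq> X}"]) blast
qed blast

lemma unions_trans:
  assumes "\<forall>C\<in>P. \<exists>D\<subseteq>Q. C = \<Union>D" "\<forall>C\<in>Q. \<exists>D\<subseteq>R. C = \<Union>D"
  shows "\<forall>C\<in>P. \<exists>D\<subseteq>R. C = \<Union>D"
  using assms unfolding union_iff by (meson subset_trans)

lemma unions_mono: "\<forall>C\<in>P. \<exists>D\<subseteq>Q. C = \<Union>D \<Longrightarrow> Q \<subseteq> R \<Longrightarrow> \<forall>C\<in>P. \<exists>D\<subseteq>R. C = \<Union>D"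
  by (meson subset_trans)

lemma union_of_classes:
  assumes "partition_on A P" "C = \<Union>D" "D \<subseteq> P" "X \<in> P" "x \<in> X" "x \<in> C"
  shows "X \<subseteq> C"
proof -
  obtain Z where "Z \<in> D" "x \<in> Z" using assms by blast
  then have "Z = X" using partition_on_same_class assms by (metis subsetD)
  then show ?thesis using \<open>Z \<in> D\<close> assms by blast
qed

lemma partial_order_coloured_graph_order: "partial_order (coloured_graph_order V)"
proof
  fix G H
  assume G: "G \<in> carrier (coloured_graph_order V)" and H: "H \<in> carrier (coloured_graph_order V)"
    and GH: "G \<sqsubseteq>\<^bsub>coloured_graph_order V\<^esub> H" and HG: "H \<sqsubseteq>\<^bsub>coloured_graph_order V\<^esub> G"
  have e: "edge_set G = edge_set H"
    using GH HG by (auto simp: coloured_graph_order_def coloured_graph_le_def)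
  moreover have "fst G = fst H"
    using GH HG by (intro refines_asym[of V])
      (simp_all add: coloured_graph_order_def coloured_graph_le_def)
  moreover have "refines (edge_set G) (snd G) (snd H)" "refines (edge_set G) (snd H) (snd G)"
    using G H GH HG e
    by (auto simp: coloured_graph_order_def coloured_graph_le_def coloured_graphs_iff
        refines_iff_unions)
  then have "snd G = snd H" by (rule refines_asym)
  ultimately show "G .=\<^bsub>coloured_graph_order V\<^esub> H"
    by (simp add: coloured_graph_order_def prod_eq_iff)
next
  fix G H K
  assume *: "G \<sqsubseteq>\<^bsub>coloured_graph_order V\<^esub> H" "H \<sqsubseteq>\<^bsub>coloured_graph_order V\<^esub> K"
  have "\<forall>C\<in>snd G. \<exists>D\<subseteq>snd K. C = \<Union>D"
  proof (rule unions_trans)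
    show "\<forall>C\<in>snd G. \<exists>D\<subseteq>snd H. C = \<Union>D" "\<forall>C\<in>snd H. \<exists>D\<subseteq>snd K. C = \<Union>D"
      using * by (simp_all add: coloured_graph_order_def coloured_graph_le_def)
  qed
  then show "G \<sqsubseteq>\<^bsub>coloured_graph_order V\<^esub> K"
    using * by (auto simp: coloured_graph_order_def coloured_graph_le_def intro: refines_trans)
next
  fix G
  assume G: "G \<in> carrier (coloured_graph_order V)"
  have "\<exists>D\<subseteq>snd G. C = \<Union>D" if "C \<in> snd G" for C
    by (rule exI[of _ "{C}"]) (use that in auto)
  then show "G \<sqsubseteq>\<^bsub>coloured_graph_order V\<^esub> G"
    using G by (auto simp: coloured_graph_order_def coloured_graph_le_def coloured_graphs_iff
        intro: refines_refl)
qed (auto simp: coloured_graph_order_def)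

lemma partition_join:
  assumes "partition_on A P" "partition_on A Q"
  shows "partition_on A (P \<squnion>\<^bsub>partition_order A\<^esub> Q)"
    "refines A P (P \<squnion>\<^bsub>partition_order A\<^esub> Q)" "refines A Q (P \<squnion>\<^bsub>partition_order A\<^esub> Q)"
    "\<And>R. refines A P R \<Longrightarrow> refines A Q R \<Longrightarrow> refines A (P \<squnion>\<^bsub>partition_order A\<^esub> Q) R"
proof -
  interpret complete_lattice "partition_order A" by (rule complete_lattice_partition_order)
  show "partition_on A (P \<squnion>\<^bsub>partition_order A\<^esub> Q)"
    using join_closed[of P Q] assms by (simp add: partition_order_def)
  show "refines A P (P \<squnion>\<^bsub>partition_order A\<^esub> Q)"
    using join_left[of P Q] assms by (simp add: partition_order_def)
  show "refines A Q (P \<squnion>\<^bsub>partition_order A\<^esub> Q)"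
    using join_right[of P Q] assms by (simp add: partition_order_def)
  show "refines A (P \<squnion>\<^bsub>partition_order A\<^esub> Q) R" if "refines A P R" "refines A Q R" for R
  proof -
    have "partition_on A R" using that by (simp add: refines_def)
    then show ?thesis using join_le[of P R Q] assms that by (simp add: partition_order_def)
  qed
qed

lemma partition_meet:
  assumes "partition_on A P" "partition_on A Q"
  shows "partition_on A (P \<sqinter>\<^bsub>partition_order A\<^esub> Q)"
    "refines A (P \<sqinter>\<^bsub>partition_order A\<^esub> Q) P" "refines A (P \<sqinter>\<^bsub>partition_order A\<^esub> Q) Q"
    "\<And>R. refines A R P \<Longrightarrow> refines A R Q \<Longrightarrow> refines A R (P \<sqinter>\<^bsub>partition_order A\<^esub> Q)"
proof -
  interpret complete_lattice "partition_order A" by (rule complete_lattice_partition_order)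
  show "partition_on A (P \<sqinter>\<^bsub>partition_order A\<^esub> Q)"
    using meet_closed[of P Q] assms by (simp add: partition_order_def)
  show "refines A (P \<sqinter>\<^bsub>partition_order A\<^esub> Q) P"
    using meet_left[of P Q] assms by (simp add: partition_order_def)
  show "refines A (P \<sqinter>\<^bsub>partition_order A\<^esub> Q) Q"
    using meet_right[of P Q] assms by (simp add: partition_order_def)
  show "refines A R (P \<sqinter>\<^bsub>partition_order A\<^esub> Q)" if "refines A R P" "refines A R Q" for R
  proof -
    have "partition_on A R" using that by (simp add: refines_def)
    then show ?thesis using meet_le[of R P Q] assms that by (simp add: partition_order_def)
  qed
qed

text \<open>\<open>\<E>\<^sup>*\<close> for the two edge colourings is the maximal pair of subsets of them that partition the
  same set of edges. It exists, even as a greatest pair.\<close>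

lemma common_classes_exist:
  "\<exists>A\<subseteq>P. \<exists>B\<subseteq>Q. \<Union>A = \<Union>B \<and>
     (\<forall>A' B'. A' \<subseteq> P \<and> B' \<subseteq> Q \<and> \<Union>A' = \<Union>B' \<longrightarrow> A' \<subseteq> A \<and> B' \<subseteq> B)"
proof -
  define T where "T = {(A, B). A \<subseteq> P \<and> B \<subseteq> Q \<and> \<Union>A = \<Union>B}"
  have "\<Union>(\<Union>(fst ` T)) = (\<Union>t\<in>T. \<Union>(fst t))" by blast
  also have "\<dots> = (\<Union>t\<in>T. \<Union>(snd t))" by (intro SUP_cong) (simp_all add: T_def case_prod_beta)
  also have "\<dots> = \<Union>(\<Union>(snd ` T))" by blast
  finally have "\<Union>(\<Union>(fst ` T)) = \<Union>(\<Union>(snd ` T))" .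
  moreover have "A' \<subseteq> \<Union>(fst ` T) \<and> B' \<subseteq> \<Union>(snd ` T)"
    if "A' \<subseteq> P \<and> B' \<subseteq> Q \<and> \<Union>A' = \<Union>B'" for A' B'
  proof -
    have "(A', B') \<in> T" using that by (simp add: T_def)
    then show ?thesis by force
  qed
  moreover have "\<Union>(fst ` T) \<subseteq> P" "\<Union>(snd ` T) \<subseteq> Q" by (auto simp: T_def)
  ultimately show ?thesis by (intro exI[of _ "\<Union>(fst ` T)"] exI[of _ "\<Union>(snd ` T)"]) auto
qed

lemma coloured_graph_meet:
  assumes G: "G \<in> coloured_graphs V" and H: "H \<in> coloured_graphs V"
    and A: "A \<subseteq> snd G" and B: "B \<subseteq> snd H" and AB: "\<Union>A = \<Union>B"
    and max: "\<And>A' B'. A \<subseteq> A' \<Longrightarrow> A' \<subseteq> snd G \<Longrightarrow> B \<subseteq> B' \<Longrightarrow> B' \<subseteq> snd H \<Longrightarrow> \<Union>A' = \<Union>B' \<Longrightarrow>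
               A' = A \<and> B' = B"
  shows "G \<sqinter>\<^bsub>coloured_graph_order V\<^esub> H =
    (fst G \<squnion>\<^bsub>partition_order V\<^esub> fst H, A \<squnion>\<^bsub>partition_order (\<Union>A)\<^esub> B)" (is "_ = ?M")
proof -
  interpret partial_order "coloured_graph_order V" by (rule partial_order_coloured_graph_order)
  define S where "S = \<Union>A"
  define J where "J = A \<squnion>\<^bsub>partition_order S\<^esub> B"
  have pG: "partition_on V (fst G)" "partition_on (edge_set G) (snd G)"
    and pH: "partition_on V (fst H)" "partition_on (edge_set H) (snd H)"
    using G H by (auto simp: coloured_graphs_iff)
  have pA: "partition_on S A" and pB: "partition_on S B"
    using partition_on_subset[OF pG(2) A] partition_on_subset[OF pH(2) B] AB
    by (simp_all add: S_def)
  note J = partition_join[OF pA pB, folded J_def]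
  note W = partition_join[OF pG(1) pH(1)]
  have M: "?M = (fst G \<squnion>\<^bsub>partition_order V\<^esub> fst H, J)" by (simp add: J_def S_def)
  have SJ: "\<Union>J = S" using J(1) by (simp add: partition_on_def)
  have SG: "S \<subseteq> edge_set G" using A by (auto simp: S_def edge_set_def)
  have SH: "S \<subseteq> edge_set H" using B AB by (auto simp: S_def edge_set_def)
  have Mc: "?M \<in> coloured_graphs V"
  proof -
    have "edge_set ?M = S" using SJ by (simp add: M edge_set_def)
    moreover have "S \<subseteq> {e. e \<subseteq> V \<and> card e = 2}"
      using SG G unfolding coloured_graphs_iff by blast
    ultimately show ?thesis unfolding coloured_graphs_iff using W(1) J(1) by (simp add: M)
  qed
  have MG: "coloured_graph_le V ?M G"
  proof -
    have "\<forall>C\<in>J. \<exists>D\<subseteq>snd G. C = \<Union>D"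
      by (rule unions_mono[OF refines_iff_unions[OF pA J(1), THEN iffD1, OF J(2)] A])
    then show ?thesis
      unfolding M coloured_graph_le_def using W(2) SG SJ by (simp add: edge_set_def)
  qed
  have MH: "coloured_graph_le V ?M H"
  proof -
    have "\<forall>C\<in>J. \<exists>D\<subseteq>snd H. C = \<Union>D"
      by (rule unions_mono[OF refines_iff_unions[OF pB J(1), THEN iffD1, OF J(3)] B])
    then show ?thesis
      unfolding M coloured_graph_le_def using W(3) SH SJ by (simp add: edge_set_def)
  qed
  have MK: "coloured_graph_le V K ?M"
    if K: "K \<in> coloured_graphs V" "coloured_graph_le V K G" "coloured_graph_le V K H" for K
  proof -
    define F where "F = snd K"
    have pF: "partition_on (\<Union>F) F" using K by (simp add: coloured_graphs_iff F_def edge_set_def)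
    have FG: "\<And>f. f \<in> F \<Longrightarrow> \<exists>D\<subseteq>snd G. f = \<Union>D" and FH: "\<And>f. f \<in> F \<Longrightarrow> \<exists>D\<subseteq>snd H. f = \<Union>D"
      using K by (auto simp: coloured_graph_le_def F_def)
    have "{c \<in> snd G. c \<subseteq> \<Union>F} \<subseteq> A \<and> {c \<in> snd H. c \<subseteq> \<Union>F} \<subseteq> B"
    proof -
      have "\<Union>{c \<in> snd G. c \<subseteq> \<Union>F} = \<Union>F"
      proof
        show "\<Union>F \<subseteq> \<Union>{c \<in> snd G. c \<subseteq> \<Union>F}"
        proof
          fix x assume "x \<in> \<Union>F"
          then obtain f where f: "f \<in> F" "x \<in> f" by blast
          with FG obtain D where "D \<subseteq> snd G" "f = \<Union>D" by blast
          with f show "x \<in> \<Union>{c \<in> snd G. c \<subseteq> \<Union>F}" by blast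
        qed
      qed auto
      moreover have "\<Union>{c \<in> snd H. c \<subseteq> \<Union>F} = \<Union>F"
      proof
        show "\<Union>F \<subseteq> \<Union>{c \<in> snd H. c \<subseteq> \<Union>F}"
        proof
          fix x assume "x \<in> \<Union>F"
          then obtain f where f: "f \<in> F" "x \<in> f" by blast
          with FH obtain D where "D \<subseteq> snd H" "f = \<Union>D" by blast
          with f show "x \<in> \<Union>{c \<in> snd H. c \<subseteq> \<Union>F}" by blast
        qed
      qed auto
      ultimately have "\<Union>(A \<union> {c \<in> snd G. c \<subseteq> \<Union>F}) = \<Union>(B \<union> {c \<in> snd H. c \<subseteq> \<Union>F})"
        using AB by simp
      then have "A \<union> {c \<in> snd G. c \<subseteq> \<Union>F} = A \<and> B \<union> {c \<in> snd H. c \<subseteq> \<Union>F} = B"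
        by (intro max) (use A B in auto)
      then show ?thesis by blast
    qed
    note sub = this
    have FS: "\<Union>F \<subseteq> S"
    proof
      fix x assume "x \<in> \<Union>F"
      then obtain f where f: "f \<in> F" "x \<in> f" by blast
      then obtain c where "c \<in> snd G" "x \<in> c" "c \<subseteq> f" using FG[unfolded union_iff] by blast
      with f sub show "x \<in> S" unfolding S_def by blast
    qed
    define F' where "F' = F \<union> ({S - \<Union>F} - {{}})"
    have pF': "partition_on S F'"
      using pF FS by (auto simp: F'_def partition_on_def disjoint_def)
    have "\<exists>Y\<in>F'. a \<subseteq> Y" if a: "a \<in> A" for a
    proof (cases "a \<inter> \<Union>F = {}")
      case True
      have "a \<subseteq> S" "a \<noteq> {}" using a pA by (auto simp: S_def partition_on_def)
      with True have "a \<subseteq> S - \<Union>F" "S - \<Union>F \<noteq> {}" by blast+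
      then show ?thesis unfolding F'_def by blast
    next
      case False
      then obtain x f where f: "f \<in> F" "x \<in> f" "x \<in> a" by blast
      with FG obtain D where "D \<subseteq> snd G" "f = \<Union>D" by blast
      then have "a \<subseteq> f" using union_of_classes[OF pG(2)] f a A by blast
      with f show ?thesis by (auto simp: F'_def)
    qed
    then have "refines S A F'" using pA pF' by (simp add: refines_def)
    moreover have "\<exists>Y\<in>F'. b \<subseteq> Y" if b: "b \<in> B" for b
    proof (cases "b \<inter> \<Union>F = {}")
      case True
      have "b \<subseteq> S" "b \<noteq> {}" using b pB by (auto simp: partition_on_def)
      with True have "b \<subseteq> S - \<Union>F" "S - \<Union>F \<noteq> {}" by blast+
      then show ?thesis unfolding F'_def by blast
    next
      case False
      then obtain x f where f: "f \<in> F" "x \<in> f" "x \<in> b" by blast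
      with FH obtain D where "D \<subseteq> snd H" "f = \<Union>D" by blast
      then have "b \<subseteq> f" using union_of_classes[OF pH(2)] f b B by blast
      with f show ?thesis by (auto simp: F'_def)
    qed
    then have "refines S B F'" using pB pF' by (simp add: refines_def)
    ultimately have "refines S J F'" by (rule J(4))
    then have "\<forall>f\<in>F. \<exists>D\<subseteq>J. f = \<Union>D"
      using refines_iff_unions[OF J(1) pF'] by (auto simp: F'_def)
    then show ?thesis
      unfolding M coloured_graph_le_def using FS SJ W(4) K
      by (auto simp: edge_set_def F_def coloured_graph_le_def)
  qed
  have "is_glb (coloured_graph_order V) ?M {G, H}"
    unfolding greatest_def
  proof (intro conjI ballI)
    have D: "K \<in> Lower (coloured_graph_order V) {G, H} \<longleftrightarrow>
        K \<in> coloured_graphs V \<and> coloured_graph_le V K G \<and> coloured_graph_le V K H" for K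
      using G H unfolding Lower_def coloured_graph_order_def
      by (simp del: split_paired_All) blast
    show "Lower (coloured_graph_order V) {G, H} \<subseteq> carrier (coloured_graph_order V)"
      unfolding Lower_def by blast
    show "?M \<in> Lower (coloured_graph_order V) {G, H}"
      unfolding D using Mc MG MH by blast
    fix K assume "K \<in> Lower (coloured_graph_order V) {G, H}"
    then have "coloured_graph_le V K ?M" unfolding D using MK by blast
    then show "K \<sqsubseteq>\<^bsub>coloured_graph_order V\<^esub> ?M" by (simp add: coloured_graph_order_def)
  qed
  moreover have "is_glb (coloured_graph_order V) (G \<sqinter>\<^bsub>coloured_graph_order V\<^esub> H) {G, H}"
    unfolding meet_def inf_def
    by (rule someI[where P = "\<lambda>K. is_glb (coloured_graph_order V) K {G, H}"])
      (rule calculation)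
  ultimately show ?thesis by (rule greatest_unique[rotated])
qed

lemma coloured_graph_join:
  assumes G: "G \<in> coloured_graphs V" and H: "H \<in> coloured_graphs V"
  shows "G \<squnion>\<^bsub>coloured_graph_order V\<^esub> H =
    (fst G \<sqinter>\<^bsub>partition_order V\<^esub> fst H,
     (snd G \<union> ({edge_set H - edge_set G} - {{}}))
       \<sqinter>\<^bsub>partition_order (edge_set G \<union> edge_set H)\<^esub>
     (snd H \<union> ({edge_set G - edge_set H} - {{}})))" (is "_ = ?M")
proof -
  interpret partial_order "coloured_graph_order V" by (rule partial_order_coloured_graph_order)
  define S where "S = edge_set G \<union> edge_set H"
  define A where "A = snd G \<union> ({edge_set H - edge_set G} - {{}})"
  define B where "B = snd H \<union> ({edge_set G - edge_set H} - {{}})"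
  define J where "J = A \<sqinter>\<^bsub>partition_order S\<^esub> B"
  have pG: "partition_on V (fst G)" "partition_on (edge_set G) (snd G)"
    and pH: "partition_on V (fst H)" "partition_on (edge_set H) (snd H)"
    using G H by (auto simp: coloured_graphs_iff)
  have pA: "partition_on S A"
    using pG(2) by (auto simp: A_def S_def partition_on_def disjoint_def)
  have pB: "partition_on S B"
    using pH(2) by (auto simp: B_def S_def partition_on_def disjoint_def)
  note J = partition_meet[OF pA pB, folded J_def]
  note W = partition_meet[OF pG(1) pH(1)]
  have M: "?M = (fst G \<sqinter>\<^bsub>partition_order V\<^esub> fst H, J)"
    by (simp add: J_def S_def A_def B_def)
  have SJ: "\<Union>J = S" using J(1) by (simp add: partition_on_def)
  have Mc: "?M \<in> coloured_graphs V"
    unfolding M using W(1) J(1) G H by (auto simp: coloured_graphs_iff edge_set_def SJ S_def)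
  have GM: "coloured_graph_le V G ?M"
    unfolding M coloured_graph_le_def using W(2) SJ refines_iff_unions[OF J(1) pA] J(2)
    by (auto simp: edge_set_def A_def S_def)
  have HM: "coloured_graph_le V H ?M"
    unfolding M coloured_graph_le_def using W(3) SJ refines_iff_unions[OF J(1) pB] J(3)
    by (auto simp: edge_set_def B_def S_def)
  have MK: "coloured_graph_le V ?M K"
    if K: "K \<in> coloured_graphs V" "coloured_graph_le V G K" "coloured_graph_le V H K" for K
  proof -
    define F where "F = {f \<in> snd K. f \<subseteq> S}"
    have pK: "partition_on (edge_set K) (snd K)" using K by (simp add: coloured_graphs_iff)
    have GK: "\<And>c. c \<in> snd G \<Longrightarrow> \<exists>D\<subseteq>snd K. c = \<Union>D" and HK: "\<And>c. c \<in> snd H \<Longrightarrow> \<exists>D\<subseteq>snd K. c = \<Union>D"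
      using K by (auto simp: coloured_graph_le_def)
    have SK: "S \<subseteq> edge_set K" using K by (auto simp: coloured_graph_le_def S_def)
    have "S \<subseteq> \<Union>F"
    proof
      fix x assume "x \<in> S"
      then obtain c where c: "x \<in> c" "c \<in> snd G \<or> c \<in> snd H" "c \<subseteq> S"
        by (auto simp: S_def edge_set_def)
      then have "\<exists>D\<subseteq>snd K. c = \<Union>D" using GK HK by blast
      then obtain f where "f \<in> snd K" "x \<in> f" "f \<subseteq> c" using c unfolding union_iff by blast
      with c show "x \<in> \<Union>F" unfolding F_def by blast
    qed
    then have "\<Union>F = S" by (auto simp: F_def)
    then have pF: "partition_on S F"
      using partition_on_subset[OF pK, of F] by (simp add: F_def)
    have "\<exists>Y\<in>A. f \<subseteq> Y" if f: "f \<in> F" for f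
    proof (cases "f \<inter> edge_set G = {}")
      case True
      have "f \<subseteq> S" "f \<noteq> {}" using f pF by (auto simp: partition_on_def)
      with True have "f \<subseteq> edge_set H - edge_set G" "edge_set H - edge_set G \<noteq> {}"
        unfolding S_def by blast+
      then show ?thesis unfolding A_def by blast
    next
      case False
      then obtain x c where c: "c \<in> snd G" "x \<in> c" "x \<in> f" by (auto simp: edge_set_def)
      with GK obtain D where "D \<subseteq> snd K" "c = \<Union>D" by blast
      then have "f \<subseteq> c" using union_of_classes[OF pK] f c by (auto simp: F_def)
      with c show ?thesis by (auto simp: A_def)
    qed
    then have "refines S F A" using pA pF by (simp add: refines_def)
    moreover have "\<exists>Y\<in>B. f \<subseteq> Y" if f: "f \<in> F" for f
    proof (cases "f \<inter> edge_set H = {}")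
      case True
      have "f \<subseteq> S" "f \<noteq> {}" using f pF by (auto simp: partition_on_def)
      with True have "f \<subseteq> edge_set G - edge_set H" "edge_set G - edge_set H \<noteq> {}"
        unfolding S_def by blast+
      then show ?thesis unfolding B_def by blast
    next
      case False
      then obtain x c where c: "c \<in> snd H" "x \<in> c" "x \<in> f" by (auto simp: edge_set_def)
      with HK obtain D where "D \<subseteq> snd K" "c = \<Union>D" by blast
      then have "f \<subseteq> c" using union_of_classes[OF pK] f c by (auto simp: F_def)
      with c show ?thesis by (auto simp: B_def)
    qed
    then have "refines S F B" using pB pF by (simp add: refines_def)
    ultimately have "refines S F J" by (rule J(4))
    then have "\<forall>c\<in>J. \<exists>D\<subseteq>F. c = \<Union>D" using refines_iff_unions[OF pF J(1)] by simp
    moreover have "F \<subseteq> snd K" by (auto simp: F_def)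
    ultimately have "\<forall>c\<in>J. \<exists>D\<subseteq>snd K. c = \<Union>D" by (meson subset_trans)
    moreover have "edge_set ?M \<subseteq> edge_set K" using SK SJ unfolding M by (simp add: edge_set_def)
    moreover have "refines V (fst K) (fst G \<sqinter>\<^bsub>partition_order V\<^esub> fst H)"
      using W(4) K by (simp add: coloured_graph_le_def)
    ultimately show ?thesis by (simp add: M coloured_graph_le_def)
  qed
  have "is_lub (coloured_graph_order V) ?M {G, H}"
    unfolding least_def
  proof (intro conjI ballI)
    have D: "K \<in> Upper (coloured_graph_order V) {G, H} \<longleftrightarrow>
        K \<in> coloured_graphs V \<and> coloured_graph_le V G K \<and> coloured_graph_le V H K" for K
      using G H unfolding Upper_def coloured_graph_order_def
      by (simp del: split_paired_All) blast
    show "Upper (coloured_graph_order V) {G, H} \<subseteq> carrier (coloured_graph_order V)"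
      unfolding Upper_def by blast
    show "?M \<in> Upper (coloured_graph_order V) {G, H}"
      unfolding D using Mc GM HM by blast
    fix K assume "K \<in> Upper (coloured_graph_order V) {G, H}"
    then have "coloured_graph_le V ?M K" unfolding D using MK by blast
    then show "?M \<sqsubseteq>\<^bsub>coloured_graph_order V\<^esub> K" by (simp add: coloured_graph_order_def)
  qed
  moreover have "is_lub (coloured_graph_order V) (G \<squnion>\<^bsub>coloured_graph_order V\<^esub> H) {G, H}"
    unfolding join_def sup_def
    by (rule someI[where P = "\<lambda>K. is_lub (coloured_graph_order V) K {G, H}"])
      (rule calculation)
  ultimately show ?thesis by (rule least_unique[rotated])
qed

end

theory Submission
  imports Defs
begin

text \<open>
  Reading off from a set of matrices which entries vanish or agree gives a map from sets of positive
  definite matrices to coloured graphs that is lower adjoint to \<open>\<G> \<mapsto> \<S>\<^sup>+(\<G>)\<close>. Diagonally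
  dominant test matrices show that models determine their graphs, so meets of coloured graphs
  correspond to intersections of models. The map \<open>s\<^sub>B\<close> is a closure operator whose closed elements
  are the edge regular graphs; hence these are closed under meets, and their joins are obtained by
  closing the joins of \<open>\<C>\<^sub>V\<close>. Distributivity already fails for edgeless graphs, where the
  partitions merging one pair of three vertices form a copy of the diamond \<open>M\<^sub>3\<close>.
\<close>

section \<open>Fibre partitions\<close>

text \<open>Indexing the classes by elements of \<open>A\<close> rather than by values of
  \<open>\<phi>\<close> excludes empty classes. Both the connection partition and the colourings of
  \<open>model_graph\<close> are of this form.\<close>

definition fibres :: "('a \<Rightarrow> 'b) \<Rightarrow> 'a set \<Rightarrow> 'a set set" where
  "fibres \<phi> A = (\<lambda>x. {y \<in> A. \<phi> y = \<phi> x}) ` A"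

lemma partition_on_fibres: "partition_on A (fibres \<phi> A)"
  by (rule partition_onI) (auto simp: fibres_def disjnt_def)

lemma Union_fibres [simp]: "\<Union>(fibres \<phi> A) = A"
  using partition_on_fibres by (metis partition_onD1)

lemma fibresE:
  assumes "C \<in> fibres \<phi> A" "x \<in> C"
  shows "C = {y \<in> A. \<phi> y = \<phi> x}" "x \<in> A"
  using assms by (auto simp: fibres_def)

text \<open>The fibres are the coarsest partition on whose classes \<open>\<phi>\<close> is
  constant. This turns refinement into constancy, the form in which edge regularity and model
  conditions are stated.\<close>

lemma refines_fibres_iff:
  assumes "partition_on A P"
  shows "refines A P (fibres \<phi> A) \<longleftrightarrow> (\<forall>C\<in>P. \<forall>x\<in>C. \<forall>y\<in>C. \<phi> x = \<phi> y)"
proof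
  assume r: "refines A P (fibres \<phi> A)"
  show "\<forall>C\<in>P. \<forall>x\<in>C. \<forall>y\<in>C. \<phi> x = \<phi> y"
  proof (intro ballI)
    fix C x y assume "C \<in> P" "x \<in> C" "y \<in> C"
    then obtain Y where "Y \<in> fibres \<phi> A" "x \<in> Y" "y \<in> Y" using r unfolding refines_def by blast
    then show "\<phi> x = \<phi> y" unfolding fibres_def by auto
  qed
next
  assume *: "\<forall>C\<in>P. \<forall>x\<in>C. \<forall>y\<in>C. \<phi> x = \<phi> y"
  have "\<exists>Y\<in>fibres \<phi> A. C \<subseteq> Y" if C: "C \<in> P" for C
  proof -
    have "C \<subseteq> A" "C \<noteq> {}" using assms C by (auto simp: partition_on_def)
    then obtain x where "x \<in> C" "x \<in> A" by blast
    then have "C \<subseteq> {y \<in> A. \<phi> y = \<phi> x}" using * C \<open>C \<subseteq> A\<close> by blast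
    then show ?thesis using \<open>x \<in> A\<close> unfolding fibres_def by blast
  qed
  then show "refines A P (fibres \<phi> A)"
    using assms partition_on_fibres by (auto simp: refines_def)
qed

lemma connection_partition_fibres:
  "connection_partition G = fibres (connected_classes (fst G)) (edge_set G)"
  unfolding connection_partition_def fibres_def by simp

section \<open>The order on coloured graphs and the closure operator \<open>s_B\<close>\<close>

lemma coloured_graph_order_simps [simp]:
  "carrier (coloured_graph_order V) = coloured_graphs V"
  "le (coloured_graph_order V) = coloured_graph_le V"
  "eq (coloured_graph_order V) = (=)"
  by (simp_all add: coloured_graph_order_def)

section \<open>Coarsening vertex colours and least edge regular graphs\<close>

lemma coloured_graphsD:
  assumes "G \<in> coloured_graphs V"
  shows "partition_on V (fst G)" "partition_on (edge_set G) (snd G)"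
    "\<And>e. e \<in> edge_set G \<Longrightarrow> e \<subseteq> V \<and> card e = 2"
  using assms by (auto simp: coloured_graphs_iff)

lemma coloured_graph_le_trans:
  assumes "coloured_graph_le V G H" "coloured_graph_le V H K"
    and "G \<in> coloured_graphs V" "H \<in> coloured_graphs V" "K \<in> coloured_graphs V"
  shows "coloured_graph_le V G K"
proof -
  interpret partial_order "coloured_graph_order V" by (rule partial_order_coloured_graph_order)
  show ?thesis using le_trans[of G H K] assms by simp
qed

text \<open>Every class of \<open>Q\<close> lies in exactly one class of \<open>P\<close>, so the
  \<open>Q\<close>-classes that an edge meets determine the \<open>P\<close>-classes that it
  meets.\<close>

lemma connected_classes_coarser:
  assumes r: "refines V Q P" and e: "e \<subseteq> V" "f \<subseteq> V"
    and eq: "connected_classes Q e = connected_classes Q f"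
  shows "connected_classes P e = connected_classes P f"
proof -
  have *: "C \<inter> h \<noteq> {}" if C: "C \<in> P" "C \<inter> g \<noteq> {}" and "g \<subseteq> V"
    and gh: "connected_classes Q g = connected_classes Q h" for C g h
  proof -
    have pQ: "partition_on V Q" and pP: "partition_on V P" using r by (auto simp: refines_def)
    obtain v where v: "v \<in> C" "v \<in> g" using C by blast
    then obtain q where q: "q \<in> Q" "v \<in> q" using pQ \<open>g \<subseteq> V\<close> by (metis UnionE partition_onD1 subsetD)
    then obtain D where D: "D \<in> P" "q \<subseteq> D" using r by (auto simp: refines_def)
    have "D = C" using partition_on_same_class[OF pP D(1) C(1), of v] D q v by blast
    moreover have "q \<inter> h \<noteq> {}" using gh q v unfolding connected_classes_def by blast
    ultimately show ?thesis using D by blast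
  qed
  have "C \<inter> e \<noteq> {} \<longleftrightarrow> C \<inter> f \<noteq> {}" if "C \<in> P" for C
    using *[OF that _ e(1) eq] *[OF that _ e(2) eq[symmetric]] by blast
  then show ?thesis unfolding connected_classes_def by (rule Collect_cong[OF conj_cong[OF refl]])
qed

context
  fixes V :: "'v set" and G :: "'v coloured_graph"
  assumes G: "G \<in> coloured_graphs V"
begin

private lemma s_B_meet:
  shows s_B_partition: "partition_on (edge_set G) (snd (s_B G))"
    and s_B_refines: "refines (edge_set G) (snd (s_B G)) (snd G)"
    and s_B_refines_conn: "refines (edge_set G) (snd (s_B G)) (connection_partition G)"
    and s_B_greatest: "\<And>R. refines (edge_set G) R (snd G) \<Longrightarrow>
       refines (edge_set G) R (connection_partition G) \<Longrightarrow> refines (edge_set G) R (snd (s_B G))"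
  using partition_meet[OF coloured_graphsD(2)[OF G]
      partition_on_fibres[of "edge_set G" "connected_classes (fst G)"]]
  unfolding s_B_def connection_partition_fibres snd_conv
  by (assumption | blast)+

lemma edge_set_s_B: "edge_set (s_B G) = edge_set G"
  using partition_onD1[OF s_B_partition] by (simp add: edge_set_def[of "s_B G"])

lemma fst_s_B: "fst (s_B G) = fst G"
  by (simp add: s_B_def)

text \<open>By the fibre criterion, refining the connection partition is the same as being edge
  regular; \<open>s_B\<close> leaves the vertex classes and the edge set alone.\<close>

lemma s_B_edge_regular: "s_B G \<in> edge_regular_graphs V"
proof -
  have "edge_regular (s_B G)"
    using s_B_refines_conn
    unfolding edge_regular_def connection_partition_fibres fst_s_B
      refines_fibres_iff[OF s_B_partition] .
  moreover have "s_B G \<in> coloured_graphs V"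
    using G s_B_partition unfolding coloured_graphs_iff edge_set_s_B fst_s_B by blast
  ultimately show ?thesis by (simp add: edge_regular_graphs_def)
qed

lemma le_s_B: "coloured_graph_le V G (s_B G)"
proof -
  have "\<forall>C\<in>snd G. \<exists>D\<subseteq>snd (s_B G). C = \<Union>D"
    using s_B_refines refines_iff_unions[OF s_B_partition coloured_graphsD(2)[OF G]] by blast
  then show ?thesis
    using refines_refl[OF coloured_graphsD(1)[OF G]]
    unfolding coloured_graph_le_def edge_set_s_B fst_s_B by (intro conjI subset_refl)
qed

text \<open>The edge classes of \<open>H\<close> inside the edge set of \<open>G\<close> refine both
  the colouring of \<open>G\<close> and its connection partition, hence their infimum. With
  \<open>le_s_B\<close>, this makes \<open>s_B G\<close> the least edge regular graph above
  \<open>G\<close>.\<close>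

lemma s_B_le:
  assumes H: "H \<in> edge_regular_graphs V" and GH: "coloured_graph_le V G H"
  shows "coloured_graph_le V (s_B G) H"
proof -
  have Hc: "H \<in> coloured_graphs V" and Hr: "edge_regular H"
    using H by (auto simp: edge_regular_graphs_def)
  \<comment> \<open>These classes cover the edges of \<open>G\<close> because each class of
    \<open>G\<close> is a union of classes of \<open>H\<close>.\<close>
  define P where "P = {p \<in> snd H. p \<subseteq> edge_set G}"
  have un: "\<exists>p\<in>snd H. x \<in> p \<and> p \<subseteq> C" if "C \<in> snd G" "x \<in> C" for C x
    using GH that unfolding coloured_graph_le_def union_iff by blast
  have "edge_set G \<subseteq> \<Union>P"
  proof
    fix x assume "x \<in> edge_set G"
    then obtain C where C: "C \<in> snd G" "x \<in> C" by (auto simp: edge_set_def)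
    then obtain p where "p \<in> snd H" "x \<in> p" "p \<subseteq> C" using un by blast
    with C show "x \<in> \<Union>P" unfolding P_def edge_set_def by blast
  qed
  then have UP: "\<Union>P = edge_set G" by (auto simp: P_def)
  then have pP: "partition_on (edge_set G) P"
    using partition_on_subset[OF coloured_graphsD(2)[OF Hc], of P] by (simp add: P_def)
  have "\<exists>D\<subseteq>P. C = \<Union>D" if C: "C \<in> snd G" for C
    unfolding union_iff
  proof
    fix x assume "x \<in> C"
    then obtain p where "p \<in> snd H" "x \<in> p" "p \<subseteq> C" using un C by blast
    with C show "\<exists>p\<in>P. x \<in> p \<and> p \<subseteq> C" unfolding P_def edge_set_def by blast
  qed
  then have 1: "refines (edge_set G) P (snd G)"
    using refines_iff_unions[OF pP coloured_graphsD(2)[OF G]] by blast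
  have 2: "refines (edge_set G) P (connection_partition G)"
    unfolding connection_partition_fibres refines_fibres_iff[OF pP]
  proof (intro ballI)
    fix C e f assume C: "C \<in> P" "e \<in> C" "f \<in> C"
    then have "e \<in> edge_set G" "f \<in> edge_set G" by (auto simp: P_def)
    \<comment> \<open>Edge regularity of \<open>H\<close> refers to its own, finer vertex classes
      and then passes to the coarser ones of \<open>G\<close>.\<close>
    moreover have "connected_classes (fst H) e = connected_classes (fst H) f"
      using Hr C by (auto simp: edge_regular_def P_def)
    moreover have "refines V (fst H) (fst G)" using GH by (simp add: coloured_graph_le_def)
    ultimately show "connected_classes (fst G) e = connected_classes (fst G) f"
      using connected_classes_coarser coloured_graphsD(3)[OF G] by blast
  qed
  have "\<forall>C\<in>snd (s_B G). \<exists>D\<subseteq>P. C = \<Union>D"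
    using s_B_greatest[OF 1 2] refines_iff_unions[OF pP s_B_partition] by blast
  then have "\<forall>C\<in>snd (s_B G). \<exists>D\<subseteq>snd H. C = \<Union>D"
    by (rule unions_mono) (auto simp: P_def)
  then show ?thesis
    using GH unfolding coloured_graph_le_def edge_set_s_B fst_s_B
    by (elim conjE) (intro conjI; assumption)
qed

end

section \<open>The Galois connection between models and coloured graphs\<close>

text \<open>The value of a symmetric matrix at an unordered pair. The arbitrary choice of an
  ordering is harmless by symmetry, and edges can be compared without naming their
  endpoints.\<close>

definition entry :: "('v \<times> 'v \<Rightarrow> real) \<Rightarrow> 'v set \<Rightarrow> real" where
  "entry K e = K (SOME p. e = {fst p, snd p})"

lemma entry_eq:
  assumes "sym_pos_def V K" "a \<in> V" "b \<in> V"
  shows "entry K {a, b} = K (a, b)"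
proof -
  define p where "p = (SOME p. {a, b} = {fst p, snd p})"
  have "{a, b} = {fst p, snd p}"
    unfolding p_def by (rule someI[of "\<lambda>p. {a, b} = {fst p, snd p}" "(a, b)"]) simp
  then have "p = (a, b) \<or> p = (b, a)" by (auto simp: doubleton_eq_iff prod_eq_iff)
  moreover have "K (a, b) = K (b, a)" using assms unfolding sym_pos_def_def by blast
  ultimately show ?thesis unfolding entry_def p_def[symmetric] by auto
qed

definition all_edges :: "'v set \<Rightarrow> 'v set set" where
  "all_edges V = {e. e \<subseteq> V \<and> card e = 2}"

lemma all_edgesE:
  assumes "e \<in> all_edges V"
  obtains a b where "e = {a, b}" "a \<noteq> b" "a \<in> V" "b \<in> V"
  using assms by (auto simp: all_edges_def card_2_iff)

lemma all_edges_doubleton: "{a, b} \<in> all_edges V \<longleftrightarrow> a \<in> V \<and> b \<in> V \<and> a \<noteq> b"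
  by (auto simp: all_edges_def card_2_iff doubleton_eq_iff)

lemma edge_set_subset: "G \<in> coloured_graphs V \<Longrightarrow> edge_set G \<subseteq> all_edges V"
  by (simp add: coloured_graphs_iff all_edges_def)

text \<open>Edges of a coloured graph are two-element subsets of \<open>V\<close>, so every pair of
  endpoints in the definition of a model lies where \<open>entry\<close> agrees with the
  matrix.\<close>

lemma rcon_model_iff:
  assumes "G \<in> coloured_graphs V"
  shows "K \<in> rcon_model V G \<longleftrightarrow> sym_pos_def V K \<and>
    (\<forall>e\<in>all_edges V - edge_set G. entry K e = 0) \<and>
    (\<forall>C\<in>fst G. \<forall>a\<in>C. \<forall>b\<in>C. K (a, a) = K (b, b)) \<and>
    (\<forall>C\<in>snd G. \<forall>e\<in>C. \<forall>f\<in>C. entry K e = entry K f)"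
proof (cases "sym_pos_def V K")
  case True
  note [simp] = entry_eq[OF True]
  have non_edges: "(\<forall>a\<in>V. \<forall>b\<in>V. a \<noteq> b \<and> {a, b} \<notin> edge_set G \<longrightarrow> K (a, b) = 0) \<longleftrightarrow>
    (\<forall>e\<in>all_edges V - edge_set G. entry K e = 0)" (is "?l \<longleftrightarrow> ?r")
  proof
    assume l: ?l
    show ?r
    proof
      fix e assume e: "e \<in> all_edges V - edge_set G"
      then obtain a b where "e = {a, b}" "a \<noteq> b" "a \<in> V" "b \<in> V" by (blast elim: all_edgesE)
      then show "entry K e = 0" using l e by simp
    qed
  next
    assume r: ?r
    show ?l
    proof (intro ballI impI)
      fix a b assume ab: "a \<in> V" "b \<in> V" "a \<noteq> b \<and> {a, b} \<notin> edge_set G"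
      then have "entry K {a, b} = 0" using r by (simp add: all_edges_doubleton)
      then show "K (a, b) = 0" using ab by simp
    qed
  qed
  have "(\<forall>a b c d. {a, b} \<in> C \<and> {c, d} \<in> C \<longrightarrow> K (a, b) = K (c, d)) \<longleftrightarrow>
      (\<forall>e\<in>C. \<forall>f\<in>C. entry K e = entry K f)" (is "?l \<longleftrightarrow> ?r") if "C \<in> snd G" for C
  proof -
    have sub: "C \<subseteq> all_edges V" using that edge_set_subset[OF assms] by (auto simp: edge_set_def)
    show ?thesis
    proof
      assume l: ?l
      show ?r
      proof (intro ballI)
        fix e f assume ef: "e \<in> C" "f \<in> C"
        obtain a b where e: "e = {a, b}" "a \<in> V" "b \<in> V" using sub ef by (meson all_edgesE subsetD)
        obtain c d where f: "f = {c, d}" "c \<in> V" "d \<in> V" using sub ef by (meson all_edgesE subsetD)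
        show "entry K e = entry K f" using l[rule_format, of a b c d] e f ef by simp
      qed
    next
      assume r: ?r
      show ?l
      proof (intro allI impI)
        fix a b c d assume *: "{a, b} \<in> C \<and> {c, d} \<in> C"
        then have "{a, b} \<in> all_edges V" "{c, d} \<in> all_edges V" using sub by blast+
        then have "a \<in> V" "b \<in> V" "c \<in> V" "d \<in> V" unfolding all_edges_doubleton by blast+
        then show "K (a, b) = K (c, d)" using r[rule_format, of "{a, b}" "{c, d}"] * by simp
      qed
    qed
  qed
  then have classes: "(\<forall>C\<in>snd G. \<forall>a b c d. {a, b} \<in> C \<and> {c, d} \<in> C \<longrightarrow> K (a, b) = K (c, d)) \<longleftrightarrow>
      (\<forall>C\<in>snd G. \<forall>e\<in>C. \<forall>f\<in>C. entry K e = entry K f)"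
    by (rule ball_cong[OF refl])
  show ?thesis by (simp only: rcon_model_def mem_Collect_eq True non_edges classes)
qed (simp add: rcon_model_def)

lemma rcon_modelD:
  assumes G: "G \<in> coloured_graphs V" and K: "K \<in> rcon_model V G"
  shows "sym_pos_def V K"
    "e \<in> all_edges V \<Longrightarrow> e \<notin> edge_set G \<Longrightarrow> entry K e = 0"
    "Y \<in> fst G \<Longrightarrow> a \<in> Y \<Longrightarrow> b \<in> Y \<Longrightarrow> K (a, a) = K (b, b)"
    "C \<in> snd G \<Longrightarrow> e \<in> C \<Longrightarrow> f \<in> C \<Longrightarrow> entry K e = entry K f"
  using K[unfolded rcon_model_iff[OF G]] by blast+

text \<open>An edge class of \<open>H\<close> either avoids the edges of \<open>G\<close>, so that
  its entries vanish, or lies inside a single edge class of \<open>G\<close>, so that its entries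
  agree.\<close>

lemma rcon_model_mono:
  assumes G: "G \<in> coloured_graphs V" and H: "H \<in> coloured_graphs V"
    and le: "coloured_graph_le V G H"
  shows "rcon_model V G \<subseteq> rcon_model V H"
proof
  fix K assume KG: "K \<in> rcon_model V G"
  note K = rcon_modelD[OF G KG]
  have "K (a, a) = K (b, b)" if "C \<in> fst H" "a \<in> C" "b \<in> C" for C a b
  proof -
    obtain Y where "Y \<in> fst G" "C \<subseteq> Y"
      using le \<open>C \<in> fst H\<close> unfolding coloured_graph_le_def refines_def by meson
    then show ?thesis using K(3)[of Y a b] that by blast
  qed
  moreover have "entry K e = entry K f" if C: "C \<in> snd H" "e \<in> C" "f \<in> C" for C e f
  proof (cases "C \<inter> edge_set G = {}")
    case True
    have "C \<subseteq> all_edges V" using C edge_set_subset[OF H] by (auto simp: edge_set_def)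
    then have "entry K e = 0" "entry K f = 0" using True C by (auto intro!: K(2))
    then show ?thesis by simp
  next
    case False
    then obtain x D where D: "D \<in> snd G" "x \<in> D" "x \<in> C" by (auto simp: edge_set_def)
    then obtain p where p: "p \<in> snd H" "x \<in> p" "p \<subseteq> D"
      using le unfolding coloured_graph_le_def union_iff by meson
    then have "p = C" using partition_on_same_class[OF coloured_graphsD(2)[OF H], of p C x] C D by blast
    then show ?thesis using K(4)[OF D(1), of e f] p C by blast
  qed
  moreover have "edge_set G \<subseteq> edge_set H" using le by (simp add: coloured_graph_le_def)
  ultimately show "K \<in> rcon_model V H" unfolding rcon_model_iff[OF H] using K(1,2) by blast
qed

text \<open>The least coloured graph whose model contains every matrix of \<open>\<K>\<close>.\<close>

definition model_graph :: "'v set \<Rightarrow> ('v \<times> 'v \<Rightarrow> real) set \<Rightarrow> 'v coloured_graph" where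
  "model_graph V \<K> = (fibres (\<lambda>v. \<lambda>K\<in>\<K>. K (v, v)) V,
     fibres (\<lambda>e. \<lambda>K\<in>\<K>. entry K e) {e \<in> all_edges V. \<exists>K\<in>\<K>. entry K e \<noteq> 0})"

lemma edge_set_model_graph:
  "edge_set (model_graph V \<K>) = {e \<in> all_edges V. \<exists>K\<in>\<K>. entry K e \<noteq> 0}"
  by (simp add: model_graph_def edge_set_def)

lemma model_graph_in: "model_graph V \<K> \<in> coloured_graphs V"
  by (auto simp: coloured_graphs_iff edge_set_model_graph)
     (auto simp: model_graph_def partition_on_fibres all_edges_def)

text \<open>The unit of the Galois connection: pairs outside the edge set are those where all
  matrices of \<open>\<K>\<close> vanish, and a colour class collects positions where each of them
  is constant.\<close>

lemma subset_rcon_model_graph: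
  assumes "\<K> \<subseteq> {K. sym_pos_def V K}"
  shows "\<K> \<subseteq> rcon_model V (model_graph V \<K>)"
proof
  fix K assume K: "K \<in> \<K>"
  \<comment> \<open>The fibre maps have functions on \<open>\<K>\<close> as values; equal functions
    agree at the given \<open>K\<close>.\<close>
  have eq: "h x K = h y K" if "C \<in> fibres h A" "x \<in> C" "y \<in> C"
    for h :: "'c \<Rightarrow> ('a \<times> 'a \<Rightarrow> real) \<Rightarrow> real" and C A x y
    using that by (auto simp: fibres_def)
  have "K (a, a) = K (b, b)" if "C \<in> fst (model_graph V \<K>)" "a \<in> C" "b \<in> C" for C a b
    using eq[of C "\<lambda>v. \<lambda>K\<in>\<K>. K (v, v)" V a b] that K by (simp add: model_graph_def)
  moreover have "entry K e = entry K f" if "C \<in> snd (model_graph V \<K>)" "e \<in> C" "f \<in> C" for C e f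
    using eq[of C "\<lambda>e. \<lambda>K\<in>\<K>. entry K e" _ e f] that K by (simp add: model_graph_def)
  ultimately show "K \<in> rcon_model V (model_graph V \<K>)"
    unfolding rcon_model_iff[OF model_graph_in] edge_set_model_graph using K assms by blast
qed

text \<open>The minimality half of the Galois connection: whatever the model of \<open>H\<close>
  forces to vanish or agree does so throughout \<open>\<K>\<close>, and \<open>model_graph\<close>
  records all such relations.\<close>

lemma model_graph_le:
  assumes H: "H \<in> coloured_graphs V" and sub: "\<K> \<subseteq> rcon_model V H"
  shows "coloured_graph_le V (model_graph V \<K>) H"
proof -
  note K = sub[THEN subsetD, unfolded rcon_model_iff[OF H]]
  have E: "edge_set (model_graph V \<K>) \<subseteq> edge_set H"
    using K by (fastforce simp: edge_set_model_graph)
  have "refines V (fst H) (fst (model_graph V \<K>))"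
    unfolding model_graph_def fst_conv refines_fibres_iff[OF coloured_graphsD(1)[OF H]]
    using K by (auto intro!: restrict_ext)
  moreover have "\<exists>D\<subseteq>snd H. C = \<Union>D" if C: "C \<in> snd (model_graph V \<K>)" for C
    unfolding union_iff
  proof
    fix e assume e: "e \<in> C"
    then have "e \<in> edge_set H" using C E by (auto simp: edge_set_def)
    then obtain p where p: "p \<in> snd H" "e \<in> p" by (auto simp: edge_set_def)
    let ?E = "{e \<in> all_edges V. \<exists>K\<in>\<K>. entry K e \<noteq> 0}"
    have Ceq: "C = {f \<in> ?E. (\<lambda>K\<in>\<K>. entry K f) = (\<lambda>K\<in>\<K>. entry K e)}" "e \<in> ?E"
      using fibresE[of C "\<lambda>e. \<lambda>K\<in>\<K>. entry K e" ?E e] C e by (auto simp: model_graph_def)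
    \<comment> \<open>Every matrix of \<open>\<K>\<close> agrees at \<open>e\<close> and
      \<open>f\<close>, so a nonzero entry at \<open>e\<close> is also one at \<open>f\<close>, and
      both edges lie in the same fibre.\<close>
    have "f \<in> C" if f: "f \<in> p" for f
    proof -
      have eq: "\<And>K. K \<in> \<K> \<Longrightarrow> entry K f = entry K e" using K p f by blast
      moreover have "f \<in> all_edges V" using edge_set_subset[OF H] p f by (auto simp: edge_set_def)
      ultimately have "f \<in> ?E" using Ceq(2) by auto
      moreover have "(\<lambda>K\<in>\<K>. entry K f) = (\<lambda>K\<in>\<K>. entry K e)" using eq by (rule restrict_ext)
      ultimately show ?thesis unfolding Ceq(1) by blast
    qed
    then show "\<exists>p\<in>snd H. e \<in> p \<and> p \<subseteq> C" using p by blast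
  qed
  ultimately show ?thesis using E by (simp add: coloured_graph_le_def)
qed

section \<open>Models determine coloured graphs\<close>

text \<open>An off-diagonal term is at least \<open>- ((x a)\<^sup>2 + (x b)\<^sup>2) / 2\<close>.
  Over all pairs these losses add up to \<open>card V\<close> times the sum of squares, and the
  diagonal bound \<open>card V + 1\<close> leaves one sum of squares over.\<close>

lemma sym_pos_def_diagonally_dominant:
  fixes V :: "'v set" and K :: "'v \<times> 'v \<Rightarrow> real"
  assumes V: "finite V" and ext: "K \<in> V \<times> V \<rightarrow>\<^sub>E UNIV"
    and sym: "\<And>a b. a \<in> V \<Longrightarrow> b \<in> V \<Longrightarrow> K (a, b) = K (b, a)"
    and diag: "\<And>a. a \<in> V \<Longrightarrow> real (card V) + 1 \<le> K (a, a)"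
    and off: "\<And>a b. a \<in> V \<Longrightarrow> b \<in> V \<Longrightarrow> a \<noteq> b \<Longrightarrow> \<bar>K (a, b)\<bar> \<le> 1"
  shows "sym_pos_def V K"
proof -
  have "0 < (\<Sum>a\<in>V. \<Sum>b\<in>V. x a * K (a, b) * x b)" if x: "\<exists>a\<in>V. x a \<noteq> 0" for x :: "'v \<Rightarrow> real"
  proof -
    let ?n = "real (card V)"
    \<comment> \<open>The loss is charged on the diagonal too, so that the double sum can be
      evaluated without excluding \<open>a = b\<close>.\<close>
    have summand: "(if a = b then (?n + 1) * (x a)\<^sup>2 else 0) - ((x a)\<^sup>2 + (x b)\<^sup>2) / 2
        \<le> x a * K (a, b) * x b" if ab: "a \<in> V" "b \<in> V" for a b
    proof (cases "a = b")
      case True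
      have "(?n + 1) * (x a)\<^sup>2 \<le> K (a, a) * (x a)\<^sup>2"
        using diag[OF ab(1)] by (intro mult_right_mono) auto
      also have "\<dots> = x a * K (a, b) * x b" using True by (simp add: power2_eq_square)
      finally have "(?n + 1) * (x a)\<^sup>2 \<le> x a * K (a, b) * x b" .
      moreover have "0 \<le> ((x a)\<^sup>2 + (x b)\<^sup>2) / 2" by simp
      ultimately show ?thesis unfolding if_P[OF True] by linarith
    next
      case False
      have "\<bar>x a * K (a, b) * x b\<bar> = \<bar>K (a, b)\<bar> * (\<bar>x a\<bar> * \<bar>x b\<bar>)" by (simp add: abs_mult)
      also have "\<dots> \<le> 1 * (\<bar>x a\<bar> * \<bar>x b\<bar>)"
        using off[OF ab False] by (intro mult_right_mono) auto
      also have "\<dots> \<le> ((x a)\<^sup>2 + (x b)\<^sup>2) / 2"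
        using sum_squares_bound[of "\<bar>x a\<bar>" "\<bar>x b\<bar>"] by simp
      finally show ?thesis unfolding if_not_P[OF False] by linarith
    qed
    have "0 < (\<Sum>a\<in>V. (x a)\<^sup>2)"
      using x V by (auto intro!: sum_pos2)
    also have "\<dots> = (?n + 1) * (\<Sum>a\<in>V. (x a)\<^sup>2) - (?n * (\<Sum>a\<in>V. (x a)\<^sup>2) + ?n * (\<Sum>a\<in>V. (x a)\<^sup>2)) / 2"
      by (simp add: field_simps)
    also have "\<dots> = (\<Sum>a\<in>V. \<Sum>b\<in>V. (if a = b then (?n + 1) * (x a)\<^sup>2 else 0)
        - ((x a)\<^sup>2 + (x b)\<^sup>2) / 2)"
      using V by (simp add: sum_subtractf sum.distrib sum_distrib_left sum_divide_distrib[symmetric])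
    also have "\<dots> \<le> (\<Sum>a\<in>V. \<Sum>b\<in>V. x a * K (a, b) * x b)"
      by (intro sum_mono summand)
    finally show ?thesis .
  qed
  then show ?thesis using ext sym unfolding sym_pos_def_def by blast
qed

text \<open>The indicators of \<open>Y\<close> and \<open>C\<close> are written on and off the
  diagonal; the base value \<open>card V + 1\<close> secures positive definiteness for every choice
  of them.\<close>

definition test_matrix :: "'v set \<Rightarrow> 'v set \<Rightarrow> 'v set set \<Rightarrow> 'v \<times> 'v \<Rightarrow> real" where
  "test_matrix V Y C = (\<lambda>(a, b)\<in>V \<times> V.
     if a = b then real (card V) + 1 + of_bool (a \<in> Y) else of_bool ({a, b} \<in> C))"

lemma test_matrix_diag: "a \<in> V \<Longrightarrow> test_matrix V Y C (a, a) = real (card V) + 1 + of_bool (a \<in> Y)"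
  by (simp add: test_matrix_def)

lemma sym_pos_def_test_matrix:
  assumes "finite V" shows "sym_pos_def V (test_matrix V Y C)"
  using assms
  by (rule sym_pos_def_diagonally_dominant)
    (auto simp: test_matrix_def insert_commute)

lemma entry_test_matrix:
  assumes "finite V" "e \<in> all_edges V"
  shows "entry (test_matrix V Y C) e = of_bool (e \<in> C)"
proof -
  obtain a b where "e = {a, b}" "a \<noteq> b" "a \<in> V" "b \<in> V" using assms(2) by (rule all_edgesE)
  then show ?thesis
    using entry_eq[OF sym_pos_def_test_matrix[OF assms(1)]] by (simp add: test_matrix_def)
qed

text \<open>The indicator of a class, or of the empty set, is constant on all classes of a
  partition. The empty choice allows one of the two colourings to be probed alone.\<close>

lemma test_matrix_in_rcon:
  assumes V: "finite V" and G: "G \<in> coloured_graphs V"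
    and Y: "Y \<in> fst G \<or> Y = {}" and C: "C \<in> snd G \<or> C = {}"
  shows "test_matrix V Y C \<in> rcon_model V G"
proof -
  let ?K = "test_matrix V Y C"
  have const: "of_bool (x \<in> X) = (of_bool (y \<in> X) :: real)"
    if "partition_on A P" "D \<in> P" "x \<in> D" "y \<in> D" "X \<in> P \<or> X = {}" for A P D X and x y :: 'c
  proof -
    have "x \<in> X \<longleftrightarrow> y \<in> X" using partition_on_same_class[OF that(1)] that by blast
    then show ?thesis by (simp add:)
  qed
  have "entry ?K e = 0" if "e \<in> all_edges V - edge_set G" for e
    using that C entry_test_matrix[OF V, of e Y C] by (auto simp: edge_set_def)
  moreover have "?K (a, a) = ?K (b, b)" if D: "D \<in> fst G" "a \<in> D" "b \<in> D" for D a b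
  proof -
    have "a \<in> V" "b \<in> V" using D coloured_graphsD(1)[OF G] by (auto simp: partition_on_def)
    then show ?thesis
      using const[OF coloured_graphsD(1)[OF G] D Y] by (simp add: test_matrix_diag)
  qed
  moreover have "entry ?K e = entry ?K f" if D: "D \<in> snd G" "e \<in> D" "f \<in> D" for D e f
  proof -
    have "e \<in> all_edges V" "f \<in> all_edges V"
      using D edge_set_subset[OF G] by (auto simp: edge_set_def)
    then show ?thesis
      using const[OF coloured_graphsD(2)[OF G] D C] by (simp add: entry_test_matrix[OF V])
  qed
  ultimately show ?thesis
    unfolding rcon_model_iff[OF G] using sym_pos_def_test_matrix[OF V] by blast
qed

text \<open>For the converse, the test matrix of a single class of \<open>G\<close> must satisfy the
  equations of \<open>H\<close>, which prevents a class of \<open>H\<close> from straddling the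
  boundary of that class.\<close>

lemma rcon_model_subset_iff:
  assumes V: "finite V" and G: "G \<in> coloured_graphs V" and H: "H \<in> coloured_graphs V"
  shows "rcon_model V G \<subseteq> rcon_model V H \<longleftrightarrow> coloured_graph_le V G H"
proof
  assume sub: "rcon_model V G \<subseteq> rcon_model V H"
  have test: "test_matrix V Y C \<in> rcon_model V H"
    if "Y \<in> fst G \<or> Y = {}" "C \<in> snd G \<or> C = {}" for Y C
    using test_matrix_in_rcon[OF V G that] sub by blast
  have edge: "\<exists>p\<in>snd H. e \<in> p \<and> p \<subseteq> C" if C: "C \<in> snd G" "e \<in> C" for C e
  proof -
    \<comment> \<open>Its entry 1 at \<open>e\<close> makes \<open>e\<close> an edge of
      \<open>H\<close>; the \<open>H\<close>-class of \<open>e\<close> then has entry 1 throughout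
      and so lies in \<open>C\<close>.\<close>
    have "test_matrix V {} C \<in> rcon_model V H" using test C by blast
    note K = rcon_modelD[OF H this]
    have e: "e \<in> all_edges V" using edge_set_subset[OF G] C by (auto simp: edge_set_def)
    then have "e \<in> edge_set H"
      using K(2)[of e] C entry_test_matrix[OF V e, of "{}" C] by auto
    then obtain p where p: "p \<in> snd H" "e \<in> p" by (auto simp: edge_set_def)
    have "f \<in> C" if f: "f \<in> p" for f
    proof -
      have "f \<in> all_edges V" using edge_set_subset[OF H] p f by (auto simp: edge_set_def)
      moreover have "entry (test_matrix V {} C) f = entry (test_matrix V {} C) e"
        using K(4)[OF p(1) f p(2)] .
      ultimately show ?thesis using C e by (simp add: entry_test_matrix[OF V])
    qed
    then show ?thesis using p by blast
  qed
  have "\<exists>Y\<in>fst G. D \<subseteq> Y" if D: "D \<in> fst H" for D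
  proof -
    have DV: "D \<subseteq> V" "D \<noteq> {}" using D coloured_graphsD(1)[OF H] by (auto simp: partition_on_def)
    then obtain a where a: "a \<in> D" "a \<in> V" by blast
    then obtain Y where Y: "Y \<in> fst G" "a \<in> Y"
      using coloured_graphsD(1)[OF G] by (metis UnionE partition_onD1)
    have "b \<in> Y" if b: "b \<in> D" for b
    proof -
      have "test_matrix V Y {} \<in> rcon_model V H" using test Y by blast
      from rcon_modelD(3)[OF H this D a(1) b]
      have "test_matrix V Y {} (a, a) = test_matrix V Y {} (b, b)" .
      moreover have "b \<in> V" using b DV by blast
      ultimately show ?thesis
        using a Y by (simp add: test_matrix_diag)
    qed
    then show ?thesis using Y by blast
  qed
  then have "refines V (fst H) (fst G)"
    using coloured_graphsD(1)[OF G] coloured_graphsD(1)[OF H] by (simp add: refines_def)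
  moreover have "edge_set G \<subseteq> edge_set H"
    using edge unfolding edge_set_def by blast
  ultimately show "coloured_graph_le V G H"
    unfolding coloured_graph_le_def union_iff using edge by (intro conjI ballI)
qed (rule rcon_model_mono[OF G H])

section \<open>The lattices\<close>

lemma rcon_sym_pos_def: "rcon_model V G \<subseteq> {K. sym_pos_def V K}"
  by (auto simp: rcon_model_def)

lemma le_model_graph:
  assumes "finite V" "G \<in> coloured_graphs V" "rcon_model V G \<subseteq> \<K>" "\<K> \<subseteq> {K. sym_pos_def V K}"
  shows "coloured_graph_le V G (model_graph V \<K>)"
  using assms subset_rcon_model_graph[OF assms(4)] rcon_model_subset_iff model_graph_in
  by (metis subset_trans)

text \<open>The infimum of a nonempty family is the graph read off from the intersection of its
  models, and the top is read off from all positive definite matrices. Finiteness of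
  \<open>V\<close> enters through the test matrices.\<close>

lemma complete_lattice_coloured_graph_order:
  assumes V: "finite V"
  shows "complete_lattice (coloured_graph_order V)"
proof -
  interpret partial_order "coloured_graph_order V" by (rule partial_order_coloured_graph_order)
  show ?thesis
  proof (rule complete_lattice_criterion1)
    have "greatest (coloured_graph_order V) (model_graph V {K. sym_pos_def V K})
        (coloured_graphs V)"
      using le_model_graph[OF V _ rcon_sym_pos_def] model_graph_in
      by (auto simp: greatest_def simp del: split_paired_All)
    then show "\<exists>g. greatest (coloured_graph_order V) g (carrier (coloured_graph_order V))"
      unfolding coloured_graph_order_simps by blast
  next
    fix A assume A: "A \<subseteq> carrier (coloured_graph_order V)" "A \<noteq> {}"
    let ?K = "\<Inter>G\<in>A. rcon_model V G"
    have K: "?K \<subseteq> {K. sym_pos_def V K}" using A rcon_sym_pos_def by blast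
    have "is_glb (coloured_graph_order V) (model_graph V ?K) A"
    proof (rule greatest_LowerI)
      fix G assume "G \<in> A"
      then show "model_graph V ?K \<sqsubseteq>\<^bsub>coloured_graph_order V\<^esub> G"
        using A model_graph_le[of G V ?K] by auto
    next
      fix H assume "H \<in> Lower (coloured_graph_order V) A"
      then have H: "H \<in> coloured_graphs V" "\<And>G. G \<in> A \<Longrightarrow> coloured_graph_le V H G"
        using A by (auto simp: Lower_def)
      have "rcon_model V H \<subseteq> rcon_model V G" if "G \<in> A" for G
        using rcon_model_mono[OF H(1) _ H(2)[OF that]] A that by auto
      then have "rcon_model V H \<subseteq> ?K" by (rule INT_greatest)
      then show "H \<sqsubseteq>\<^bsub>coloured_graph_order V\<^esub> model_graph V ?K"
        using le_model_graph[OF V H(1) _ K] by simp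
    qed (use A model_graph_in in auto)
    then show "\<exists>i. is_glb (coloured_graph_order V) i A" by blast
  qed
qed

section \<open>Edge regular models under inclusion\<close>

lemma edge_regular_models_simps [simp]:
  "carrier (edge_regular_models V) = rcon_model V ` edge_regular_graphs V"
  "le (edge_regular_models V) = (\<subseteq>)"
  "eq (edge_regular_models V) = (=)"
  by (simp_all add: edge_regular_models_def)

lemma edge_regular_in_coloured: "G \<in> edge_regular_graphs V \<Longrightarrow> G \<in> coloured_graphs V"
  by (simp add: edge_regular_graphs_def)

text \<open>The graph \<open>?N\<close> read off from the intersection \<open>?K\<close> lies below
  every member of \<open>A\<close>, and so does \<open>s_B ?N\<close> as the members are edge
  regular. Hence the model of \<open>s_B ?N\<close> is exactly \<open>?K\<close>. The factor of all
  positive definite matrices gives the top element for \<open>A = {}\<close>.\<close>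

lemma Inter_edge_regular_models:
  assumes "A \<subseteq> edge_regular_graphs V"
  shows "{K. sym_pos_def V K} \<inter> (\<Inter>G\<in>A. rcon_model V G) \<in> rcon_model V ` edge_regular_graphs V"
proof -
  let ?K = "{K. sym_pos_def V K} \<inter> (\<Inter>G\<in>A. rcon_model V G)"
  let ?N = "model_graph V ?K"
  note N = model_graph_in[of V ?K]
  note sN = edge_regular_in_coloured[OF s_B_edge_regular[OF N]]
  have "rcon_model V (s_B ?N) \<subseteq> rcon_model V G" if "G \<in> A" for G
  proof -
    have G: "G \<in> edge_regular_graphs V" "G \<in> coloured_graphs V"
      using that assms edge_regular_in_coloured by blast+
    then have "coloured_graph_le V ?N G" using that by (intro model_graph_le) auto
    then show ?thesis using rcon_model_mono[OF sN G(2) s_B_le[OF N G(1)]] by blast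
  qed
  then have "rcon_model V (s_B ?N) \<subseteq> ?K" using rcon_sym_pos_def by blast
  moreover have "?K \<subseteq> rcon_model V (s_B ?N)"
    using subset_rcon_model_graph[of ?K V] rcon_model_mono[OF N sN le_s_B[OF N]] by blast
  ultimately show ?thesis using s_B_edge_regular[OF N] by blast
qed

lemma complete_lattice_edge_regular_models: "complete_lattice (edge_regular_models V)"
proof -
  interpret partial_order "edge_regular_models V" by unfold_locales auto
  show ?thesis
  proof (rule complete_lattice_criterion1)
    have "greatest (edge_regular_models V) {K. sym_pos_def V K} (carrier (edge_regular_models V))"
      using Inter_edge_regular_models[of "{}" V] rcon_sym_pos_def by (auto simp: greatest_def)
    then show "\<exists>g. greatest (edge_regular_models V) g (carrier (edge_regular_models V))" by blast
  next
    fix A assume A: "A \<subseteq> carrier (edge_regular_models V)" "A \<noteq> {}"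
    then obtain B where B: "B \<subseteq> edge_regular_graphs V" "A = rcon_model V ` B"
      by (auto simp: subset_image_iff)
    have "\<Inter>A \<subseteq> {K. sym_pos_def V K}" using A(2) B(2) rcon_sym_pos_def by blast
    then have "\<Inter>A = {K. sym_pos_def V K} \<inter> (\<Inter>G\<in>B. rcon_model V G)" using B(2) by blast
    then have "\<Inter>A \<in> carrier (edge_regular_models V)"
      using Inter_edge_regular_models[OF B(1)] by simp
    then have "is_glb (edge_regular_models V) (\<Inter>A) A"
      using A by (intro greatest_LowerI) (auto simp: Lower_def)
    then show "\<exists>i. is_glb (edge_regular_models V) i A" by blast
  qed
qed

section \<open>Binary meets and joins\<close>

lemma edge_regular_models_meet:
  assumes "a \<in> carrier (edge_regular_models V)" "b \<in> carrier (edge_regular_models V)"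
  shows "a \<sqinter>\<^bsub>edge_regular_models V\<^esub> b = a \<inter> b"
proof -
  interpret complete_lattice "edge_regular_models V" by (rule complete_lattice_edge_regular_models)
  obtain G H where GH: "G \<in> edge_regular_graphs V" "a = rcon_model V G"
    "H \<in> edge_regular_graphs V" "b = rcon_model V H" using assms by auto
  have "{K. sym_pos_def V K} \<inter> (a \<inter> b) = a \<inter> b" using rcon_sym_pos_def GH by blast
  then have c: "a \<inter> b \<in> carrier (edge_regular_models V)"
    using Inter_edge_regular_models[of "{G, H}" V] GH by simp
  show ?thesis
    using meet_left[OF assms] meet_right[OF assms] meet_le[of "a \<inter> b" a b] c assms
    unfolding edge_regular_models_simps(2) by blast
qed

text \<open>The graph read off from the intersection is below \<open>G\<close> and \<open>H\<close>,
  hence below their meet, so the intersection lies in the model of the meet. Monotonicity gives the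
  other inclusion.\<close>

lemma rcon_model_meet:
  assumes V: "finite V" and G: "G \<in> coloured_graphs V" and H: "H \<in> coloured_graphs V"
  shows "rcon_model V (G \<sqinter>\<^bsub>coloured_graph_order V\<^esub> H) = rcon_model V G \<inter> rcon_model V H"
proof -
  interpret complete_lattice "coloured_graph_order V"
    by (rule complete_lattice_coloured_graph_order[OF V])
  let ?M = "G \<sqinter>\<^bsub>coloured_graph_order V\<^esub> H"
  let ?N = "model_graph V (rcon_model V G \<inter> rcon_model V H)"
  have M: "?M \<in> coloured_graphs V" "coloured_graph_le V ?M G" "coloured_graph_le V ?M H"
    using meet_closed[of G H] meet_left[of G H] meet_right[of G H] G H by simp_all
  have "coloured_graph_le V ?N ?M"
    using meet_le[of ?N G H] model_graph_le[OF G] model_graph_le[OF H] model_graph_in G H by auto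
  then have "rcon_model V ?N \<subseteq> rcon_model V ?M" using M rcon_model_mono model_graph_in by metis
  moreover have "rcon_model V G \<inter> rcon_model V H \<subseteq> rcon_model V ?N"
    by (rule subset_rcon_model_graph) (use rcon_sym_pos_def in blast)
  ultimately show ?thesis using rcon_model_mono M G H by blast
qed

text \<open>The join is the model of some edge regular \<open>L\<close>. Inclusion of models
  reflects to the graphs, so \<open>L\<close> is above \<open>G\<close> and \<open>H\<close>, then
  above their join, and by \<open>s_B_le\<close> above its closure.\<close>

lemma edge_regular_models_join:
  assumes V: "finite V" and G: "G \<in> edge_regular_graphs V" and H: "H \<in> edge_regular_graphs V"
  shows "rcon_model V G \<squnion>\<^bsub>edge_regular_models V\<^esub> rcon_model V H =
         rcon_model V (s_B (G \<squnion>\<^bsub>coloured_graph_order V\<^esub> H))"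
proof -
  interpret C: complete_lattice "coloured_graph_order V"
    by (rule complete_lattice_coloured_graph_order[OF V])
  interpret M: complete_lattice "edge_regular_models V"
    by (rule complete_lattice_edge_regular_models)
  note Gc = edge_regular_in_coloured[OF G] and Hc = edge_regular_in_coloured[OF H]
  let ?J = "G \<squnion>\<^bsub>coloured_graph_order V\<^esub> H"
  let ?a = "rcon_model V G" and ?b = "rcon_model V H"
  have J: "?J \<in> coloured_graphs V" "coloured_graph_le V G ?J" "coloured_graph_le V H ?J"
    using C.join_closed[of G H] C.join_left[of G H] C.join_right[of G H] Gc Hc by simp_all
  note sJ = s_B_edge_regular[OF J(1)]
  note sJc = edge_regular_in_coloured[OF sJ]
  have ab: "?a \<in> carrier (edge_regular_models V)" "?b \<in> carrier (edge_regular_models V)"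
    using G H by auto
  have "?a \<subseteq> rcon_model V (s_B ?J)" "?b \<subseteq> rcon_model V (s_B ?J)"
    using coloured_graph_le_trans[OF J(2) le_s_B[OF J(1)] Gc J(1) sJc]
      coloured_graph_le_trans[OF J(3) le_s_B[OF J(1)] Hc J(1) sJc] rcon_model_mono Gc Hc sJc by metis+
  then have "?a \<squnion>\<^bsub>edge_regular_models V\<^esub> ?b \<subseteq> rcon_model V (s_B ?J)"
    using M.join_le[of ?a "rcon_model V (s_B ?J)" ?b] ab sJ by simp
  moreover have "rcon_model V (s_B ?J) \<subseteq> ?a \<squnion>\<^bsub>edge_regular_models V\<^esub> ?b"
  proof -
    obtain L where L: "L \<in> edge_regular_graphs V"
      "?a \<squnion>\<^bsub>edge_regular_models V\<^esub> ?b = rcon_model V L"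
      using M.join_closed[OF ab] by auto
    note Lc = edge_regular_in_coloured[OF L(1)]
    have "?a \<subseteq> rcon_model V L" "?b \<subseteq> rcon_model V L"
      using M.join_left[OF ab] M.join_right[OF ab] L(2) by simp_all
    then have "coloured_graph_le V G L" "coloured_graph_le V H L"
      using rcon_model_subset_iff[OF V] Gc Hc Lc by auto
    then have "coloured_graph_le V ?J L" using C.join_le[of G L H] Gc Hc Lc by simp
    then show ?thesis
      using rcon_model_mono[OF sJc Lc s_B_le[OF J(1) L(1)]] L(2) by simp
  qed
  ultimately show ?thesis by (rule subset_antisym)
qed

section \<open>Failure of distributivity\<close>

text \<open>Without edges, edge regularity is vacuous and the model consists of diagonal matrices
  subject to one equation.\<close>

definition merge_graph :: "'v set \<Rightarrow> 'v \<Rightarrow> 'v \<Rightarrow> 'v coloured_graph" where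
  "merge_graph V x y = (insert {x, y} ((\<lambda>v. {v}) ` (V - {x, y})), {})"

lemma merge_graph_edge_regular:
  assumes "x \<in> V" "y \<in> V" shows "merge_graph V x y \<in> edge_regular_graphs V"
  using assms
  by (auto simp: merge_graph_def edge_regular_graphs_def edge_regular_def coloured_graphs_iff
      edge_set_def partition_on_def disjoint_def)

lemma rcon_merge_graph:
  "rcon_model V (merge_graph V x y) = {K. sym_pos_def V K \<and>
     (\<forall>a\<in>V. \<forall>b\<in>V. a \<noteq> b \<longrightarrow> K (a, b) = 0) \<and> K (x, x) = K (y, y)}"
  by (auto simp: rcon_model_def merge_graph_def edge_set_def)

lemma test_matrix_in_merge:
  assumes "finite V" "x \<in> V" "y \<in> V"
  shows "test_matrix V Y {} \<in> rcon_model V (merge_graph V x y) \<longleftrightarrow> (x \<in> Y \<longleftrightarrow> y \<in> Y)"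
  using assms sym_pos_def_test_matrix[of V Y "{}"]
  by (auto simp: rcon_merge_graph test_matrix_def)

text \<open>A vertex colouring refining both merges is discrete, so an upper bound of two distinct merges
  puts no restriction on the diagonal.\<close>

lemma upper_bound_merges:
  assumes V: "finite V" and xyz: "x \<in> V" "y \<in> V" "z \<in> V" "x \<noteq> y" "y \<noteq> z" "x \<noteq> z"
    and L: "L \<in> coloured_graphs V"
    and 1: "rcon_model V (merge_graph V x y) \<subseteq> rcon_model V L"
    and 2: "rcon_model V (merge_graph V y z) \<subseteq> rcon_model V L"
  shows "test_matrix V Y {} \<in> rcon_model V L"
proof -
  have "a = b" if D: "D \<in> fst L" "a \<in> D" "b \<in> D" for D a b
  proof (rule ccontr)
    assume "a \<noteq> b"
    have ab: "a \<in> V" "b \<in> V" using D coloured_graphsD(1)[OF L] by (auto simp: partition_on_def)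
    \<comment> \<open>The two merged pairs share only \<open>y\<close>. One of \<open>a\<close>,
      \<open>b\<close> differs from \<open>y\<close> and thus avoids one of the pairs, whose model
      then contains the test matrix of \<open>{w}\<close>.\<close>
    obtain w where w: "w = a \<or> w = b" "w \<notin> {x, y} \<or> w \<notin> {y, z}"
      using \<open>a \<noteq> b\<close> xyz by blast
    have "test_matrix V {w} {} \<in> rcon_model V L"
      using w(2) 1 2 test_matrix_in_merge[OF V, of x y "{w}"]
        test_matrix_in_merge[OF V, of y z "{w}"] xyz by auto
    from rcon_modelD(3)[OF L this D]
    have "test_matrix V {w} {} (a, a) = test_matrix V {w} {} (b, b)" .
    then show False
      using w(1) \<open>a \<noteq> b\<close> ab by (auto simp: test_matrix_diag)
  qed
  then have "test_matrix V Y {} (a, a) = test_matrix V Y {} (b, b)"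
    if "D \<in> fst L" "a \<in> D" "b \<in> D" for D a b using that by metis
  moreover have zero: "entry (test_matrix V Y {}) e = 0" if "e \<in> all_edges V" for e
    using entry_test_matrix[OF V that] by simp
  moreover have "entry (test_matrix V Y {}) e = entry (test_matrix V Y {}) f"
    if "C \<in> snd L" "e \<in> C" "f \<in> C" for C e f
  proof -
    have "e \<in> all_edges V" "f \<in> all_edges V"
      using that edge_set_subset[OF L] by (auto simp: edge_set_def)
    then show ?thesis by (simp add: zero)
  qed
  ultimately show ?thesis
    unfolding rcon_model_iff[OF L] using sym_pos_def_test_matrix[OF V] by blast
qed

text \<open>Two of the three merges imply the third, so \<open>?a\<close> joined with the meet of
  \<open>?b\<close> and \<open>?c\<close> is just \<open>?a\<close>. Both joins of \<open>?a\<close>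
  contain the diagonal test matrix of \<open>{x}\<close>, which separates \<open>x\<close> from
  \<open>y\<close> and is therefore outside \<open>?a\<close>.\<close>

lemma not_distributive_edge_regular_models:
  assumes V: "finite V" and card: "3 \<le> card V"
  shows "\<not> distributive (edge_regular_models V)"
proof
  assume d: "distributive (edge_regular_models V)"
  interpret complete_lattice "edge_regular_models V" by (rule complete_lattice_edge_regular_models)
  obtain T where "T \<subseteq> V" "card T = 3" using card by (meson obtain_subset_with_card_n)
  then obtain x y z where xyz: "x \<in> V" "y \<in> V" "z \<in> V" "x \<noteq> y" "y \<noteq> z" "x \<noteq> z"
    by (auto simp: card_3_iff)
  let ?L = "edge_regular_models V"
  let ?a = "rcon_model V (merge_graph V x y)" and ?b = "rcon_model V (merge_graph V y z)"
    and ?c = "rcon_model V (merge_graph V x z)"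
  have car: "?a \<in> carrier ?L" "?b \<in> carrier ?L" "?c \<in> carrier ?L"
    using xyz merge_graph_edge_regular by (metis edge_regular_models_simps(1) imageI)+
  have "?b \<sqinter>\<^bsub>?L\<^esub> ?c \<subseteq> ?a"
    using edge_regular_models_meet[OF car(2,3)] by (auto simp: rcon_merge_graph)
  then have "?a \<squnion>\<^bsub>?L\<^esub> (?b \<sqinter>\<^bsub>?L\<^esub> ?c) \<subseteq> ?a"
    using join_le[of ?a ?a "?b \<sqinter>\<^bsub>?L\<^esub> ?c"] car meet_closed[OF car(2,3)] by simp
  then have sub: "(?a \<squnion>\<^bsub>?L\<^esub> ?b) \<sqinter>\<^bsub>?L\<^esub> (?a \<squnion>\<^bsub>?L\<^esub> ?c) \<subseteq> ?a"
    using d car unfolding distributive_def by metis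
  have "test_matrix V {x} {} \<in> ?a \<squnion>\<^bsub>?L\<^esub> ?b"
  proof -
    obtain L where L': "L \<in> edge_regular_graphs V" and L: "?a \<squnion>\<^bsub>?L\<^esub> ?b = rcon_model V L"
      using join_closed[OF car(1,2)] unfolding edge_regular_models_simps(1) by blast
    then show ?thesis
      using upper_bound_merges[OF V xyz edge_regular_in_coloured[OF L']] join_left[OF car(1,2)] join_right[OF car(1,2)] L
      by simp
  qed
  moreover have "test_matrix V {x} {} \<in> ?a \<squnion>\<^bsub>?L\<^esub> ?c"
  proof -
    obtain L where L': "L \<in> edge_regular_graphs V" and L: "?a \<squnion>\<^bsub>?L\<^esub> ?c = rcon_model V L"
      using join_closed[OF car(1,3)] unfolding edge_regular_models_simps(1) by blast
    \<comment> \<open>\<open>upper_bound_merges\<close> wants the shared vertex in the middle; here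
      that vertex is \<open>x\<close>, so the first pair is reversed.\<close>
    have "rcon_model V (merge_graph V y x) = ?a" by (auto simp: rcon_merge_graph)
    then show ?thesis
      using upper_bound_merges[OF V xyz(2,1,3) _ xyz(6,5) edge_regular_in_coloured[OF L']] xyz(4)
        join_left[OF car(1,3)] join_right[OF car(1,3)] L
      by simp
  qed
  ultimately have "test_matrix V {x} {} \<in> ?a"
    using sub edge_regular_models_meet[OF join_closed[OF car(1,2)] join_closed[OF car(1,3)]] by blast
  then show False using test_matrix_in_merge[OF V xyz(1,2)] xyz(4) by simp
qed

text \<open>The meet claim holds because both sides equal the intersection of the two models. Three
  vertices are the threshold for non-distributivity: on two, merging the vertices and having the
  edge are independent choices, which gives a product of two chains.\<close>

theorem theorem5p3:
  fixes V :: "'v set"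
  assumes "finite V"
  shows "complete_lattice (edge_regular_models V) \<and>
    (3 \<le> card V \<longrightarrow> \<not> distributive (edge_regular_models V)) \<and>
    (\<forall>G\<in>edge_regular_graphs V. \<forall>H\<in>edge_regular_graphs V.
       rcon_model V G \<sqinter>\<^bsub>edge_regular_models V\<^esub> rcon_model V H =
         rcon_model V (G \<sqinter>\<^bsub>coloured_graph_order V\<^esub> H) \<and>
       rcon_model V G \<squnion>\<^bsub>edge_regular_models V\<^esub> rcon_model V H =
         rcon_model V (s_B (G \<squnion>\<^bsub>coloured_graph_order V\<^esub> H)))"
  using assms complete_lattice_edge_regular_models not_distributive_edge_regular_models
    edge_regular_models_join rcon_model_meet edge_regular_models_meet edge_regular_in_coloured
  by (metis (no_types, lifting) edge_regular_models_simps(1) imageI)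

end
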